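(* Let $k$ be an algebraically closed field of any characteristic. Every non-zero cubic form $h\in k[x,y]$ can be brought to exactly one of the following three forms by a linear change of coordinates: (1) $x^3$; (2) $x^2y$; (3) $xy(x+y)$, or any other cubic form with three distinct roots (that is, in this third case $xy(x+y)$ may be replaced by any fixed cubic form with three distinct roots in $\mathbb P^1$). Moreover, when $k$ has characteristic $p>0$, all of these define non-$F$-pure quotients $k[x,y]/\langle h\rangle$.
   Context: A ring $R$ of prime characteristic $p$ is $F$-pure if its Frobenius map $R\to R$, $r\mapsto r^p$, is pure, i.e. it stays injective after tensoring with any $R$-module. *)

theory Defs
  imports "HOL-Algebra.Algebra" "HOL-Algebra.Algebraic_Closure_Type"
    "HOL-Computational_Algebra.Computational_Algebra"
begin

section \<open>Binary forms\<close>

text \<open>The polynomial ring \<open>k[x,y]\<close> is represented as \<open>k[x][y]\<close>, that is by the type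
  \<^typ>\<open>'a poly poly\<close>: the coefficient of \<open>x\<^sup>i y\<^sup>j\<close> in \<open>h\<close> is \<open>coeff (coeff h j) i\<close>.\<close>

definition varX :: "'a::comm_ring_1 poly poly" where
  "varX = [:[:0, 1:]:]"

definition varY :: "'a::comm_ring_1 poly poly" where
  "varY = [:0, 1:]"

definition const2 :: "'a::comm_ring_1 \<Rightarrow> 'a poly poly" where
  "const2 c = [:[:c:]:]"

definition is_form :: "nat \<Rightarrow> 'a::comm_ring_1 poly poly \<Rightarrow> bool" where
  "is_form d h \<longleftrightarrow> (\<forall>i j. coeff (coeff h j) i \<noteq> 0 \<longrightarrow> i + j = d)"

text \<open>The polynomial \<open>h(u, v)\<close> for \<open>u, v \<in> k[x,y]\<close>.\<close>

definition subst2 :: "'a::comm_ring_1 poly poly \<Rightarrow> 'a poly poly \<Rightarrow> 'a poly poly \<Rightarrow> 'a poly poly" where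
  "subst2 h u v = poly (map_poly (\<lambda>q. poly (map_poly const2 q) u) h) v"

text \<open>The value \<open>h(a, b) \<in> k\<close>: first \<open>y := b\<close>, then \<open>x := a\<close>.\<close>

definition eval2 :: "'a::comm_ring_1 poly poly \<Rightarrow> 'a \<Rightarrow> 'a \<Rightarrow> 'a" where
  "eval2 h a b = poly (poly h [:b:]) a"

definition brought_to :: "'a::field poly poly \<Rightarrow> 'a poly poly \<Rightarrow> bool" where
  "brought_to h g \<longleftrightarrow> (\<exists>a b c d. a * d - b * c \<noteq> 0 \<and>
     subst2 h (const2 a * varX + const2 b * varY) (const2 c * varX + const2 d * varY) = g)"

text \<open>Points of \<open>\<bbbP>\<^sup>1(k)\<close> are the lines through the origin of \<open>k\<^sup>2\<close>.\<close>

definition P1 :: "('a::field \<times> 'a) set set" where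
  "P1 = {{(t * a, t * b) |t. True} |a b. (a, b) \<noteq> (0, 0)}"

definition roots_P1 :: "'a::field poly poly \<Rightarrow> ('a \<times> 'a) set set" where
  "roots_P1 h = {L \<in> P1. \<forall>(a, b)\<in>L. eval2 h a b = 0}"

text \<open>The zero form over an infinite field is excluded automatically, since then
  \<^term>\<open>roots_P1 h\<close> is infinite and its cardinality is 0.\<close>

definition cubic_with_three_distinct_roots :: "'a::field poly poly \<Rightarrow> bool" where
  "cubic_with_three_distinct_roots g \<longleftrightarrow> is_form 3 g \<and> card (roots_P1 g) = 3"

definition quotient_ring2 :: "'a::field poly poly \<Rightarrow> 'a poly poly set ring" where
  "quotient_ring2 h = ring_of_type_algebra Quot (PIdl\<^bsub>ring_of_type_algebra\<^esub> h)"


section \<open>Tensor products of modules\<close>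

text \<open>\<open>M \<otimes>\<^sub>R N\<close> is the free abelian group on \<open>M \<times> N\<close> modulo the subgroup generated by
  the bilinearity relations.\<close>

definition tensor_relations ::
  "('r, 'x) ring_scheme \<Rightarrow> ('r, 'a, 'y) module_scheme \<Rightarrow> ('r, 'b, 'z) module_scheme
    \<Rightarrow> ('a \<times> 'b \<Rightarrow>\<^sub>0 int) set" where
  "tensor_relations R M N =
     {frag_of (x \<oplus>\<^bsub>M\<^esub> x', y) - frag_of (x, y) - frag_of (x', y) |x x' y.
        x \<in> carrier M \<and> x' \<in> carrier M \<and> y \<in> carrier N} \<union>
     {frag_of (x, y \<oplus>\<^bsub>N\<^esub> y') - frag_of (x, y) - frag_of (x, y') |x y y'.
        x \<in> carrier M \<and> y \<in> carrier N \<and> y' \<in> carrier N} \<union>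
     {frag_of (r \<odot>\<^bsub>M\<^esub> x, y) - frag_of (x, r \<odot>\<^bsub>N\<^esub> y) |r x y.
        r \<in> carrier R \<and> x \<in> carrier M \<and> y \<in> carrier N}"

definition tensor_subgroup ::
  "('r, 'x) ring_scheme \<Rightarrow> ('r, 'a, 'y) module_scheme \<Rightarrow> ('r, 'b, 'z) module_scheme
    \<Rightarrow> ('a \<times> 'b \<Rightarrow>\<^sub>0 int) set" where
  "tensor_subgroup R M N =
     generate (free_Abelian_group (carrier M \<times> carrier N)) (tensor_relations R M N)"

definition tensor_product ::
  "('r, 'x) ring_scheme \<Rightarrow> ('r, 'a, 'y) module_scheme \<Rightarrow> ('r, 'b, 'z) module_scheme
    \<Rightarrow> ('a \<times> 'b \<Rightarrow>\<^sub>0 int) set monoid" where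
  "tensor_product R M N =
     free_Abelian_group (carrier M \<times> carrier N) Mod tensor_subgroup R M N"

definition frag_map :: "('a \<Rightarrow> 'b) \<Rightarrow> ('a \<Rightarrow>\<^sub>0 int) \<Rightarrow> ('b \<Rightarrow>\<^sub>0 int)" where
  "frag_map f = frag_extend (\<lambda>x. frag_of (f x))"

text \<open>For an \<open>R\<close>-linear map \<open>f : M \<rightarrow> M'\<close>, the following is \<open>f \<otimes> N : M \<otimes>\<^sub>R N \<rightarrow> M' \<otimes>\<^sub>R N\<close>,
  \<open>x \<otimes> y \<mapsto> f x \<otimes> y\<close>. It acts on cosets; the union is over one and the same coset.\<close>

definition tensor_map ::
  "('r, 'x) ring_scheme \<Rightarrow> ('r, 'c, 'y) module_scheme \<Rightarrow> ('r, 'b, 'z) module_scheme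
    \<Rightarrow> ('a \<Rightarrow> 'c) \<Rightarrow> ('a \<times> 'b \<Rightarrow>\<^sub>0 int) set \<Rightarrow> ('c \<times> 'b \<Rightarrow>\<^sub>0 int) set" where
  "tensor_map R M' N f C =
     (\<Union>c\<in>C. tensor_subgroup R M' N #>\<^bsub>free_Abelian_group (carrier M' \<times> carrier N)\<^esub>
        frag_map (map_prod f id) c)"


section \<open>Purity\<close>

text \<open>The ring \<open>S\<close> as an \<open>R\<close>-module through \<open>\<phi> : R \<rightarrow> S\<close>.\<close>

definition module_via :: "('r \<Rightarrow> 's) \<Rightarrow> ('s, 'x) ring_scheme \<Rightarrow> ('r, 's) module" where
  "module_via \<phi> S = \<lparr>carrier = carrier S, monoid.mult = monoid.mult S, one = one S, ring.zero = ring.zero S,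
     add = add S, module.smult = (\<lambda>r s. \<phi> r \<otimes>\<^bsub>S\<^esub> s)\<rparr>"

text \<open>\<open>pure_on TYPE('m) R S \<phi>\<close> says that the ring homomorphism \<open>\<phi>\<close> stays injective after
  tensoring with any \<open>R\<close>-module whose carrier lies in \<^typ>\<open>'m\<close>.\<close>

definition pure_on :: "'m itself \<Rightarrow> 'r ring \<Rightarrow> 's ring \<Rightarrow> ('r \<Rightarrow> 's) \<Rightarrow> bool" where
  "pure_on (_ :: 'm itself) R S \<phi> \<longleftrightarrow>
     (\<forall>M :: ('r, 'm) module. module R M \<longrightarrow>
        inj_on (tensor_map R (module_via \<phi> S) M \<phi>)
          (carrier (tensor_product R (module_via id R) M)))"

text \<open>A definition cannot quantify over all types. The type \<^typ>\<open>nat \<Rightarrow> 'r\<close> has room for a copy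
  of every finitely generated \<open>R\<close>-module, and these suffice: by the theorem \<open>pure_hom_imp_pure_on\<close>
  below, a map that is pure in the following sense stays injective after tensoring with any
  \<open>R\<close>-module, over an arbitrary type.\<close>

definition pure_hom :: "'r ring \<Rightarrow> 's ring \<Rightarrow> ('r \<Rightarrow> 's) \<Rightarrow> bool" where
  "pure_hom R S \<phi> \<longleftrightarrow> pure_on TYPE(nat \<Rightarrow> 'r) R S \<phi>"

text \<open>Here \<open>p\<close> is the prime characteristic of \<open>R\<close>.\<close>

definition F_pure :: "nat \<Rightarrow> 'r ring \<Rightarrow> bool" where
  "F_pure p R \<longleftrightarrow> pure_hom R R (\<lambda>r. r [^]\<^bsub>R\<^esub> p)"


section \<open>Purity does not depend on the type of the modules\<close>

lemma frag_map_simps [simp]: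
  "frag_map f 0 = 0"
  "frag_map f (frag_of x) = frag_of (f x)"
  "frag_map f (a + b) = frag_map f a + frag_map f b"
  "frag_map f (a - b) = frag_map f a - frag_map f b"
  "frag_map f (- a) = - frag_map f a"
  by (simp_all add: frag_map_def frag_extend_add frag_extend_diff frag_extend_minus)

lemma frag_map_compose: "frag_map f (frag_map g c) = frag_map (f \<circ> g) c"
  using frag_extend_compose[of "\<lambda>x. frag_of (f x)" g c]
  by (simp add: frag_map_def o_def)

lemma frag_map_cong:
  "(\<And>x. x \<in> Poly_Mapping.keys c \<Longrightarrow> f x = g x) \<Longrightarrow> frag_map f c = frag_map g c"
  unfolding frag_map_def by (rule frag_extend_eq) simp

lemma frag_map_ident: "(\<And>x. x \<in> Poly_Mapping.keys c \<Longrightarrow> f x = x) \<Longrightarrow> frag_map f c = c"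
  using frag_map_cong[of c f id] frag_expansion[of c] by (simp add: frag_map_def)

lemma keys_frag_map: "Poly_Mapping.keys (frag_map f c) \<subseteq> f ` Poly_Mapping.keys c"
  unfolding frag_map_def using keys_frag_extend[of "\<lambda>x. frag_of (f x)" c] by auto

text \<open>What is used of a module in the formation of tensor products.\<close>

definition closed_ops :: "('r, 'x) ring_scheme \<Rightarrow> ('r, 'a, 'y) module_scheme \<Rightarrow> bool" where
  "closed_ops R M \<longleftrightarrow> (\<forall>x\<in>carrier M. \<forall>y\<in>carrier M. x \<oplus>\<^bsub>M\<^esub> y \<in> carrier M) \<and>
     (\<forall>r\<in>carrier R. \<forall>x\<in>carrier M. r \<odot>\<^bsub>M\<^esub> x \<in> carrier M)"

definition linear_on :: "('r, 'x) ring_scheme \<Rightarrow> ('r, 'a, 'y) module_scheme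
    \<Rightarrow> ('r, 'b, 'z) module_scheme \<Rightarrow> ('a \<Rightarrow> 'b) \<Rightarrow> bool" where
  "linear_on R M N f \<longleftrightarrow> f ` carrier M \<subseteq> carrier N \<and>
     (\<forall>x\<in>carrier M. \<forall>y\<in>carrier M. f (x \<oplus>\<^bsub>M\<^esub> y) = f x \<oplus>\<^bsub>N\<^esub> f y) \<and>
     (\<forall>r\<in>carrier R. \<forall>x\<in>carrier M. f (r \<odot>\<^bsub>M\<^esub> x) = r \<odot>\<^bsub>N\<^esub> f x)"

lemma tensor_relations_subset:
  assumes "closed_ops R M" "closed_ops R N"
  shows "tensor_relations R M N \<subseteq> carrier (free_Abelian_group (carrier M \<times> carrier N))"
  using assms unfolding tensor_relations_def closed_ops_def
  by (auto dest!: subsetD[OF keys_diff])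

lemma tensor_subgroup_subgroup:
  assumes "closed_ops R M" "closed_ops R N"
  shows "subgroup (tensor_subgroup R M N) (free_Abelian_group (carrier M \<times> carrier N))"
  unfolding tensor_subgroup_def
  by (rule group.generate_is_subgroup) (simp_all add: tensor_relations_subset[OF assms])

lemma tensor_subgroup_closed:
  assumes "closed_ops R M" "closed_ops R N"
  shows "0 \<in> tensor_subgroup R M N"
    and "a \<in> tensor_subgroup R M N \<Longrightarrow> b \<in> tensor_subgroup R M N \<Longrightarrow> a + b \<in> tensor_subgroup R M N"
    and "a \<in> tensor_subgroup R M N \<Longrightarrow> - a \<in> tensor_subgroup R M N"
    and "a \<in> tensor_subgroup R M N \<Longrightarrow> b \<in> tensor_subgroup R M N \<Longrightarrow> a - b \<in> tensor_subgroup R M N"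
    and "a \<in> tensor_relations R M N \<Longrightarrow> a \<in> tensor_subgroup R M N"
    and "a \<in> tensor_subgroup R M N \<Longrightarrow> Poly_Mapping.keys a \<subseteq> carrier M \<times> carrier N"
proof -
  let ?F = "free_Abelian_group (carrier M \<times> carrier N)"
  interpret K: subgroup "tensor_subgroup R M N" ?F
    by (rule tensor_subgroup_subgroup[OF assms])
  show sub: "Poly_Mapping.keys a \<subseteq> carrier M \<times> carrier N" if "a \<in> tensor_subgroup R M N" for a
    using subsetD[OF K.subset that] by simp
  show "0 \<in> tensor_subgroup R M N"
    using K.one_closed by simp
  show add: "a + b \<in> tensor_subgroup R M N"
    if "a \<in> tensor_subgroup R M N" "b \<in> tensor_subgroup R M N" for a b
    using K.m_closed[OF that] by simp
  show uminus: "- a \<in> tensor_subgroup R M N" if "a \<in> tensor_subgroup R M N" for a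
    using K.m_inv_closed[OF that] sub[OF that] by simp
  show "a - b \<in> tensor_subgroup R M N"
    if "a \<in> tensor_subgroup R M N" "b \<in> tensor_subgroup R M N"
    using add[OF that(1) uminus[OF that(2)]] by simp
  show "a \<in> tensor_subgroup R M N" if "a \<in> tensor_relations R M N"
    using that unfolding tensor_subgroup_def by (rule generate.incl)
qed

lemma tensor_subgroup_induct [consumes 3, case_names zero rel add uminus]:
  assumes M: "closed_ops R M" and N: "closed_ops R N" and "a \<in> tensor_subgroup R M N"
    and "P 0" and rel: "\<And>a. a \<in> tensor_relations R M N \<Longrightarrow> P a"
    and "\<And>a b. P a \<Longrightarrow> P b \<Longrightarrow> P (a + b)" and uminus: "\<And>a. P a \<Longrightarrow> P (- a)"
  shows "P a"
  using assms(3) unfolding tensor_subgroup_def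
proof (induction rule: generate.induct)
  case (inv h)
  then have "Poly_Mapping.keys h \<subseteq> carrier M \<times> carrier N"
    using subsetD[OF tensor_relations_subset[OF M N]] by simp
  then show ?case using rel[OF inv] uminus by simp
qed (use assms in auto)

lemma tensor_subgroup_map:
  assumes cl: "closed_ops R M" "closed_ops R N" "closed_ops R M'" "closed_ops R N'"
    and f: "linear_on R M M' f" and g: "linear_on R N N' g"
    and "c \<in> tensor_subgroup R M N"
  shows "frag_map (map_prod f g) c \<in> tensor_subgroup R M' N'"
  using cl(1,2) assms(7)
proof (induction rule: tensor_subgroup_induct)
  case (rel a)
  have "frag_map (map_prod f g) a \<in> tensor_relations R M' N'"
    using rel f g unfolding tensor_relations_def linear_on_def image_subset_iff
    by (elim UnE CollectE exE conjE) (simp, blast)+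
  then show ?case by (rule tensor_subgroup_closed(5)[OF cl(3,4)])
qed (use tensor_subgroup_closed[OF cl(3,4)] in auto)

lemma tensor_subgroup_finite_support:
  assumes cl: "closed_ops R M" "closed_ops R N" and "c \<in> tensor_subgroup R M N"
  shows "\<exists>F. finite F \<and> F \<subseteq> carrier N \<and>
           (\<forall>H. F \<subseteq> H \<longrightarrow> closed_ops R (N\<lparr>carrier := H\<rparr>) \<longrightarrow>
              c \<in> tensor_subgroup R M (N\<lparr>carrier := H\<rparr>))"
  using cl assms(3)
proof (induction rule: tensor_subgroup_induct)
  case zero
  then show ?case by (auto intro!: exI[of _ "{}"] tensor_subgroup_closed(1) cl)
next
  case (rel a)
  have "\<exists>F. finite F \<and> F \<subseteq> carrier N \<and>
          (\<forall>H. F \<subseteq> H \<longrightarrow> a \<in> tensor_relations R M (N\<lparr>carrier := H\<rparr>))"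
    using rel unfolding tensor_relations_def
  proof (elim UnE CollectE exE conjE, goal_cases)
    case (1 x x' y)
    then show ?case by (intro exI[of _ "{y}"]) auto
  next
    case (2 x y y')
    then show ?case by (intro exI[of _ "{y, y'}"]) auto
  next
    case (3 r x y)
    then show ?case by (intro exI[of _ "{y}"]) auto
  qed
  then show ?case using tensor_subgroup_closed(5)[OF cl(1)] by metis
next
  case (add a b)
  then obtain F F' where
    "finite F" "F \<subseteq> carrier N" "finite F'" "F' \<subseteq> carrier N"
    "\<forall>H. F \<subseteq> H \<longrightarrow> closed_ops R (N\<lparr>carrier := H\<rparr>) \<longrightarrow>
       a \<in> tensor_subgroup R M (N\<lparr>carrier := H\<rparr>)"
    "\<forall>H. F' \<subseteq> H \<longrightarrow> closed_ops R (N\<lparr>carrier := H\<rparr>) \<longrightarrow>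
       b \<in> tensor_subgroup R M (N\<lparr>carrier := H\<rparr>)"
    by auto
  then show ?case
    by (intro exI[of _ "F \<union> F'"]) (auto intro!: tensor_subgroup_closed(2)[OF cl(1)])
next
  case (uminus a)
  then show ?case using tensor_subgroup_closed(3)[OF cl(1)] by metis
qed

lemma (in module) closed_ops_self: "closed_ops R M"
  by (auto simp: closed_ops_def)

lemma (in module) closed_ops_submodule:
  "submodule H R M \<Longrightarrow> closed_ops R (M\<lparr>carrier := H\<rparr>)"
  using submoduleE[of H] by (auto simp: closed_ops_def)

lemma (in module) finite_subset_small_submodule:
  assumes "finite F" "F \<subseteq> carrier M"
  shows "\<exists>H (g :: 'c \<Rightarrow> nat \<Rightarrow> 'a). F \<subseteq> H \<and> submodule H R M \<and> inj_on g H"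
  using assms
proof (induction F rule: finite_induct)
  case empty
  have "submodule {\<zero>\<^bsub>M\<^esub>} R M"
    by (rule submoduleI) auto
  then show ?case by (intro exI[of _ "{\<zero>\<^bsub>M\<^esub>}"]) auto
next
  case (insert m F)
  then obtain H and g :: "'c \<Rightarrow> nat \<Rightarrow> 'a" where
    H: "F \<subseteq> H" "submodule H R M" "inj_on g H" and m: "m \<in> carrier M"
    by auto
  note HE = submoduleE[OF H(2)]
  define H' where "H' = {x \<oplus>\<^bsub>M\<^esub> r \<odot>\<^bsub>M\<^esub> m |x r. x \<in> H \<and> r \<in> carrier R}"
  have zero: "\<zero>\<^bsub>M\<^esub> \<in> H"
    using HE(1,2,4) by (metis R.zero_closed ex_in_conv smult_l_null subsetD)
  have "submodule H' R M"
  proof (rule submoduleI)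
    show "H' \<subseteq> carrier M"
      using HE(1) m by (auto simp: H'_def)
    show "\<zero>\<^bsub>M\<^esub> \<in> H'"
      unfolding H'_def using zero m
      by (auto intro!: exI[of _ "\<zero>\<^bsub>M\<^esub>"] exI[of _ \<zero>])
    show "\<ominus>\<^bsub>M\<^esub> a \<in> H'" if "a \<in> H'" for a
    proof -
      from that obtain x r where a: "a = x \<oplus>\<^bsub>M\<^esub> r \<odot>\<^bsub>M\<^esub> m" "x \<in> H" "r \<in> carrier R"
        by (auto simp: H'_def)
      then have "\<ominus>\<^bsub>M\<^esub> a = \<ominus>\<^bsub>M\<^esub> x \<oplus>\<^bsub>M\<^esub> (\<ominus> r) \<odot>\<^bsub>M\<^esub> m"
        using HE(1) m by (simp add: subset_iff smult_l_minus M.minus_add)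
      then show ?thesis using a HE(3) by (auto simp: H'_def)
    qed
    show "a \<oplus>\<^bsub>M\<^esub> b \<in> H'" if "a \<in> H'" "b \<in> H'" for a b
    proof -
      from that obtain x r y s where a: "a = x \<oplus>\<^bsub>M\<^esub> r \<odot>\<^bsub>M\<^esub> m" "x \<in> H" "r \<in> carrier R"
        and b: "b = y \<oplus>\<^bsub>M\<^esub> s \<odot>\<^bsub>M\<^esub> m" "y \<in> H" "s \<in> carrier R"
        by (auto simp: H'_def)
      then have "a \<oplus>\<^bsub>M\<^esub> b = (x \<oplus>\<^bsub>M\<^esub> y) \<oplus>\<^bsub>M\<^esub> (r \<oplus> s) \<odot>\<^bsub>M\<^esub> m"
        using HE(1) m by (simp add: subset_iff smult_l_distr M.a_ac)
      then show ?thesis using a b HE(5) by (auto simp: H'_def)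
    qed
    show "t \<odot>\<^bsub>M\<^esub> a \<in> H'" if "t \<in> carrier R" "a \<in> H'" for t a
    proof -
      from that obtain x r where a: "a = x \<oplus>\<^bsub>M\<^esub> r \<odot>\<^bsub>M\<^esub> m" "x \<in> H" "r \<in> carrier R"
        by (auto simp: H'_def)
      then have "t \<odot>\<^bsub>M\<^esub> a = t \<odot>\<^bsub>M\<^esub> x \<oplus>\<^bsub>M\<^esub> (t \<otimes> r) \<odot>\<^bsub>M\<^esub> m"
        using HE(1) m that(1) by (simp add: subset_iff smult_r_distr smult_assoc1)
      then show ?thesis using a HE(4) that(1) by (auto simp: H'_def)
    qed
  qed
  moreover have "insert m F \<subseteq> H'"
  proof -
    have "m \<in> H'"
      unfolding H'_def using zero m
      by (auto intro!: exI[of _ "\<zero>\<^bsub>M\<^esub>"] exI[of _ \<one>])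
    moreover have "x \<in> H'" if "x \<in> H" for x
      unfolding H'_def using that m HE(1)
      by (auto intro!: exI[of _ x] exI[of _ \<zero>])
    ultimately show ?thesis using H(1) by auto
  qed
  moreover have "\<exists>g' :: 'c \<Rightarrow> nat \<Rightarrow> 'a. inj_on g' H'"
  proof -
    have "\<forall>z\<in>H'. \<exists>x r. x \<in> H \<and> z = x \<oplus>\<^bsub>M\<^esub> r \<odot>\<^bsub>M\<^esub> m"
      by (auto simp: H'_def)
    then obtain \<xi> \<rho> where
      \<xi>: "\<And>z. z \<in> H' \<Longrightarrow> \<xi> z \<in> H \<and> z = \<xi> z \<oplus>\<^bsub>M\<^esub> \<rho> z \<odot>\<^bsub>M\<^esub> m"
      by metis
    have "inj_on (\<lambda>z. case_nat (\<rho> z) (g (\<xi> z))) H'"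
    proof (rule inj_onI)
      fix z w assume zw: "z \<in> H'" "w \<in> H'"
        and eq: "case_nat (\<rho> z) (g (\<xi> z)) = case_nat (\<rho> w) (g (\<xi> w))"
      have "\<rho> z = \<rho> w" using fun_cong[OF eq, of 0] by simp
      moreover have "g (\<xi> z) = g (\<xi> w)"
        using fun_cong[OF eq, of "Suc _"] by (intro ext) simp
      then have "\<xi> z = \<xi> w" using \<xi> zw H(3) by (meson inj_onD)
      ultimately show "z = w" using \<xi>[OF zw(1)] \<xi>[OF zw(2)] by metis
    qed
    then show ?thesis by blast
  qed
  ultimately show ?case by blast
qed

lemma (in module) transport_module:
  fixes g :: "'c \<Rightarrow> 'e"
  assumes H: "submodule H R M" and g: "inj_on g H"
  shows "\<exists>N :: ('a, 'e) module. module R N \<and> carrier N = g ` H \<and>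
           linear_on R (M\<lparr>carrier := H\<rparr>) N g \<and>
           linear_on R N (M\<lparr>carrier := H\<rparr>) (inv_into H g)"
proof -
  note HE = submoduleE[OF H]
  define h where "h = inv_into H g"
  have h [simp]: "h (g x) = x" if "x \<in> H" for x
    unfolding h_def using g that by simp
  have zero [simp]: "\<zero>\<^bsub>M\<^esub> \<in> H"
    using HE(1,2,4) by (metis R.zero_closed ex_in_conv smult_l_null subsetD)
  have [simp]: "x \<in> carrier M" if "x \<in> H" for x
    using that HE(1) by auto
  note [simp] = HE(3,4,5)
  define N :: "('a, 'e) module" where
    "N = \<lparr>carrier = g ` H, monoid.mult = undefined, one = undefined, ring.zero = g \<zero>\<^bsub>M\<^esub>,
      add = (\<lambda>x y. g (h x \<oplus>\<^bsub>M\<^esub> h y)), module.smult = (\<lambda>r x. g (r \<odot>\<^bsub>M\<^esub> h x))\<rparr>"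
  have "\<exists>y\<in>carrier N. y \<oplus>\<^bsub>N\<^esub> x = \<zero>\<^bsub>N\<^esub>" if "x \<in> carrier N" for x
    using that by (intro bexI[of _ "g (\<ominus>\<^bsub>M\<^esub> h x)"]) (auto simp: N_def M.l_neg)
  then have "abelian_group N"
    by (intro abelian_groupI) (auto simp: N_def M.a_ac)
  then have "module R N"
    by (intro moduleI R.is_cring)
      (auto simp: N_def smult_l_distr smult_r_distr smult_assoc1)
  moreover have "linear_on R (M\<lparr>carrier := H\<rparr>) N g"
    by (auto simp: linear_on_def N_def)
  moreover have "linear_on R N (M\<lparr>carrier := H\<rparr>) h"
    by (auto simp: linear_on_def N_def)
  moreover have "carrier N = g ` H" by (simp add: N_def)
  ultimately show ?thesis unfolding h_def by blast
qed

lemma pure_on_iff: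
  fixes R :: "'r ring" and S :: "'s ring"
  assumes R: "cring R" and S: "cring S" and \<phi>: "\<phi> \<in> ring_hom R S"
  shows "pure_on TYPE('m) R S \<phi> \<longleftrightarrow>
    (\<forall>M :: ('r, 'm) module. module R M \<longrightarrow>
       (\<forall>c. Poly_Mapping.keys c \<subseteq> carrier R \<times> carrier M \<longrightarrow>
          frag_map (map_prod \<phi> id) c \<in> tensor_subgroup R (module_via \<phi> S) M \<longrightarrow>
          c \<in> tensor_subgroup R (module_via id R) M))"
  (is "_ \<longleftrightarrow> (\<forall>M. _ \<longrightarrow> ?P M)")
proof -
  interpret R: cring R by fact
  interpret S: cring S by fact
  have clR: "closed_ops R (module_via id R)"
    by (auto simp: closed_ops_def module_via_def)
  have clS: "closed_ops R (module_via \<phi> S)"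
    using \<phi> by (auto simp: closed_ops_def module_via_def ring_hom_closed)
  have lin: "linear_on R (module_via id R) (module_via \<phi> S) \<phi>"
    using \<phi> by (auto simp: linear_on_def module_via_def ring_hom_closed ring_hom_add ring_hom_mult)
  have "inj_on (tensor_map R (module_via \<phi> S) M \<phi>)
          (carrier (tensor_product R (module_via id R) M)) \<longleftrightarrow> ?P M"
    if M: "module R M" for M :: "('r, 'm) module"
  proof -
    interpret M: module R M by fact
    let ?K = "tensor_subgroup R (module_via id R) M"
    let ?K' = "tensor_subgroup R (module_via \<phi> S) M"
    let ?F = "free_Abelian_group (carrier R \<times> carrier M)"
    let ?F' = "free_Abelian_group (carrier S \<times> carrier M)"
    let ?f = "frag_map (map_prod \<phi> (id :: 'm \<Rightarrow> 'm))"
    have [simp]: "carrier (module_via id R) = carrier R" "carrier (module_via \<phi> S) = carrier S"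
      by (simp_all add: module_via_def)
    note K = tensor_subgroup_closed[OF clR M.closed_ops_self]
    note K' = tensor_subgroup_closed[OF clS M.closed_ops_self]
    have fK: "?f c \<in> ?K'" if "c \<in> ?K" for c
      by (rule tensor_subgroup_map[OF clR M.closed_ops_self clS M.closed_ops_self lin _ that])
        (simp add: linear_on_def)
    have coset: "?K #>\<^bsub>?F\<^esub> c = {d. d - c \<in> ?K}" for c
      by (force simp: r_coset_def)
    have coset': "?K' #>\<^bsub>?F'\<^esub> c = {d. d - c \<in> ?K'}" for c
      by (force simp: r_coset_def)
    have map: "tensor_map R (module_via \<phi> S) M \<phi> (?K #>\<^bsub>?F\<^esub> c) = ?K' #>\<^bsub>?F'\<^esub> ?f c" for c
    proof -
      have "d - ?f c \<in> ?K'" if "e - c \<in> ?K" "d - ?f e \<in> ?K'" for d e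
        using K'(2)[OF that(2) fK[OF that(1)]] by simp
      moreover have "\<exists>e. e - c \<in> ?K \<and> d - ?f e \<in> ?K'" if "d - ?f c \<in> ?K'" for d
        using K(1) that by (intro exI[of _ c]) simp
      ultimately show ?thesis
        by (simp add: tensor_map_def coset coset') blast
    qed
    have car: "carrier (tensor_product R (module_via id R) M) =
        (\<lambda>c. ?K #>\<^bsub>?F\<^esub> c) ` {c. Poly_Mapping.keys c \<subseteq> carrier R \<times> carrier M}"
    proof -
      have "carrier ?F = {c. Poly_Mapping.keys c \<subseteq> carrier R \<times> carrier M}"
        by (simp add: free_Abelian_group_def)
      then show ?thesis
        by (simp add: tensor_product_def FactGroup_def RCOSETS_def UNION_singleton_eq_range)
    qed
    have eq: "?K #>\<^bsub>?F\<^esub> c = ?K #>\<^bsub>?F\<^esub> d \<longleftrightarrow> c - d \<in> ?K" for c d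
    proof
      assume eq: "?K #>\<^bsub>?F\<^esub> c = ?K #>\<^bsub>?F\<^esub> d"
      have "c \<in> ?K #>\<^bsub>?F\<^esub> c" using K(1) by (simp only: coset mem_Collect_eq diff_self)
      then show "c - d \<in> ?K" unfolding eq by (simp only: coset mem_Collect_eq)
    next
      assume cd: "c - d \<in> ?K"
      have "e - d \<in> ?K" if "e - c \<in> ?K" for e using K(2)[OF that cd] by simp
      moreover have "e - c \<in> ?K" if "e - d \<in> ?K" for e using K(4)[OF that cd] by simp
      ultimately show "?K #>\<^bsub>?F\<^esub> c = ?K #>\<^bsub>?F\<^esub> d" unfolding coset by blast
    qed
    have eq': "?K' #>\<^bsub>?F'\<^esub> c = ?K' #>\<^bsub>?F'\<^esub> d \<longleftrightarrow> c - d \<in> ?K'" for c d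
    proof
      assume eq: "?K' #>\<^bsub>?F'\<^esub> c = ?K' #>\<^bsub>?F'\<^esub> d"
      have "c \<in> ?K' #>\<^bsub>?F'\<^esub> c" using K'(1) by (simp only: coset' mem_Collect_eq diff_self)
      then show "c - d \<in> ?K'" unfolding eq by (simp only: coset' mem_Collect_eq)
    next
      assume cd: "c - d \<in> ?K'"
      have "e - d \<in> ?K'" if "e - c \<in> ?K'" for e using K'(2)[OF that cd] by simp
      moreover have "e - c \<in> ?K'" if "e - d \<in> ?K'" for e using K'(4)[OF that cd] by simp
      ultimately show "?K' #>\<^bsub>?F'\<^esub> c = ?K' #>\<^bsub>?F'\<^esub> d" unfolding coset' by blast
    qed
    have "inj_on (tensor_map R (module_via \<phi> S) M \<phi>)
            (carrier (tensor_product R (module_via id R) M)) \<longleftrightarrow>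
          (\<forall>c d. Poly_Mapping.keys c \<subseteq> carrier R \<times> carrier M \<longrightarrow>
             Poly_Mapping.keys d \<subseteq> carrier R \<times> carrier M \<longrightarrow>
             ?f c - ?f d \<in> ?K' \<longrightarrow> c - d \<in> ?K)"
      unfolding car inj_on_def by (auto simp: map eq eq')
    also have "\<dots> \<longleftrightarrow> ?P M"
    proof (intro iffI allI impI)
      fix c assume *: "\<forall>c d. Poly_Mapping.keys c \<subseteq> carrier R \<times> carrier M \<longrightarrow>
             Poly_Mapping.keys d \<subseteq> carrier R \<times> carrier M \<longrightarrow>
             ?f c - ?f d \<in> ?K' \<longrightarrow> c - d \<in> ?K"
        and "Poly_Mapping.keys c \<subseteq> carrier R \<times> carrier M" "?f c \<in> ?K'"
      then show "c \<in> ?K" using *[rule_format, of c 0] by simp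
    next
      fix c d assume *: "?P M" and "Poly_Mapping.keys c \<subseteq> carrier R \<times> carrier M"
        "Poly_Mapping.keys d \<subseteq> carrier R \<times> carrier M" "?f c - ?f d \<in> ?K'"
      moreover from this have "Poly_Mapping.keys (c - d) \<subseteq> carrier R \<times> carrier M"
        using keys_diff[of c d] by blast
      ultimately show "c - d \<in> ?K" using *[rule_format, of "c - d"] by simp
    qed
    finally show ?thesis .
  qed
  then show ?thesis unfolding pure_on_def by blast
qed

theorem pure_hom_imp_pure_on:
  fixes R :: "'r ring" and S :: "'s ring"
  assumes R: "cring R" and S: "cring S" and \<phi>: "\<phi> \<in> ring_hom R S"
    and pure: "pure_hom R S \<phi>"
  shows "pure_on TYPE('m) R S \<phi>"
  unfolding pure_on_iff[OF R S \<phi>]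
proof (intro allI impI)
  fix M :: "('r, 'm) module" and c
  assume M: "module R M" and keys: "Poly_Mapping.keys c \<subseteq> carrier R \<times> carrier M"
    and c: "frag_map (map_prod \<phi> id) c \<in> tensor_subgroup R (module_via \<phi> S) M"
  interpret R: cring R by fact
  interpret S: cring S by fact
  interpret M: module R M by fact
  have clR: "closed_ops R (module_via id R)"
    by (auto simp: closed_ops_def module_via_def)
  have clS: "closed_ops R (module_via \<phi> S)"
    using \<phi> by (auto simp: closed_ops_def module_via_def ring_hom_closed)
  have lin_id: "linear_on R (module_via id R) (module_via id R) id"
    "linear_on R (module_via \<phi> S) (module_via \<phi> S) id"
    by (simp_all add: linear_on_def)
  obtain F where F: "finite F" "F \<subseteq> carrier M"
    "\<And>H. F \<subseteq> H \<Longrightarrow> closed_ops R (M\<lparr>carrier := H\<rparr>) \<Longrightarrow>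
       frag_map (map_prod \<phi> id) c \<in> tensor_subgroup R (module_via \<phi> S) (M\<lparr>carrier := H\<rparr>)"
    using tensor_subgroup_finite_support[OF clS M.closed_ops_self c] by metis
  have "finite (F \<union> snd ` Poly_Mapping.keys c)" "F \<union> snd ` Poly_Mapping.keys c \<subseteq> carrier M"
    using F(1,2) keys by auto
  from M.finite_subset_small_submodule[OF this] obtain H and g :: "'m \<Rightarrow> nat \<Rightarrow> 'r"
    where H: "F \<subseteq> H" "snd ` Poly_Mapping.keys c \<subseteq> H" "submodule H R M" "inj_on g H"
    by auto
  let ?H = "M\<lparr>carrier := H\<rparr>"
  have clH: "closed_ops R ?H" by (rule M.closed_ops_submodule[OF H(3)])
  from M.transport_module[OF H(3,4)] obtain N :: "('r, nat \<Rightarrow> 'r) module"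
    where N: "module R N" "carrier N = g ` H" "linear_on R ?H N g"
      "linear_on R N ?H (inv_into H g)"
    by auto
  interpret N: module R N by fact
  have keysH: "Poly_Mapping.keys c \<subseteq> carrier R \<times> H"
  proof
    fix z assume "z \<in> Poly_Mapping.keys c"
    then have "z \<in> carrier R \<times> carrier M" "snd z \<in> H"
      using keys H(2) by (auto simp only: subset_iff image_subset_iff)
    then show "z \<in> carrier R \<times> H" by (auto simp: mem_Times_iff)
  qed
  let ?c = "frag_map (map_prod id g) c"
  have "frag_map (map_prod id g) (frag_map (map_prod \<phi> id) c) \<in> tensor_subgroup R (module_via \<phi> S) N"
    by (rule tensor_subgroup_map[OF clS clH clS N.closed_ops_self lin_id(2) N(3) F(3)[OF H(1) clH]])
  moreover have "frag_map (map_prod id g) (frag_map (map_prod \<phi> id) c) =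
      frag_map (map_prod \<phi> id) ?c"
    unfolding frag_map_compose by (rule frag_map_cong) auto
  ultimately have "frag_map (map_prod \<phi> id) ?c \<in> tensor_subgroup R (module_via \<phi> S) N"
    by simp
  moreover have "Poly_Mapping.keys ?c \<subseteq> carrier R \<times> carrier N"
  proof -
    have "map_prod id g ` (carrier R \<times> H) \<subseteq> carrier R \<times> carrier N"
      using N(2) by auto
    then show ?thesis
      using keys_frag_map[of "map_prod id g" c] keysH by blast
  qed
  ultimately have "?c \<in> tensor_subgroup R (module_via id R) N"
    using pure[unfolded pure_hom_def pure_on_iff[OF R S \<phi>]] N(1) by blast
  then have "frag_map (map_prod id (inv_into H g)) ?c \<in> tensor_subgroup R (module_via id R) ?H"
    by (rule tensor_subgroup_map[OF clR N.closed_ops_self clR clH lin_id(1) N(4)])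
  moreover have "frag_map (map_prod id (inv_into H g)) ?c = c"
    unfolding frag_map_compose
  proof (rule frag_map_ident)
    fix z assume "z \<in> Poly_Mapping.keys c"
    then have "snd z \<in> H" using keysH by auto
    then show "(map_prod id (inv_into H g) \<circ> map_prod id g) z = z"
      using H(4) by (cases z) simp
  qed
  ultimately have "c \<in> tensor_subgroup R (module_via id R) ?H"
    by simp
  moreover have "linear_on R ?H M id"
    using M.submoduleE(1)[OF H(3)] by (auto simp: linear_on_def)
  ultimately have "frag_map (map_prod id id) c \<in> tensor_subgroup R (module_via id R) M"
    by (intro tensor_subgroup_map[OF clR clH clR M.closed_ops_self lin_id(1)])
  then show "c \<in> tensor_subgroup R (module_via id R) M"
    using frag_map_ident[of c id] by (simp add: map_prod.id)
qed

end

theory Submission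
  imports Defs
begin

text \<open>A form \<open>f\<close> that vanishes at a point \<open>(s, u)\<close> of the projective line is divisible by the linear
  form \<open>ux - sy\<close>, so over an algebraically closed field a binary cubic is a product of three linear
  forms (\<^emph>\<open>form_expand\<close>, \<^emph>\<open>cubic_form_splits\<close>). If all three are proportional, the cubic is a cube
  up to a constant, and a cube root absorbs the constant. Otherwise two of them are independent and
  serve as coordinates \<open>x\<close> and \<open>y\<close>; the third is \<open>px + qy\<close>, and rescaling gives \<open>x\<^sup>2y\<close> or
  \<open>xy(x + y)\<close> (\<^emph>\<open>cubic_normal_form\<close>). The three normal forms have one, two and three roots in the
  projective line, and a linear change of coordinates preserves this number, so they exclude each
  other. A cubic \<open>g\<close> with three distinct roots must have \<open>xy(x + y)\<close> as its normal form, and as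
  equivalence of forms is transitive, \<open>g\<close> can take its place (\<^emph>\<open>unique_normal_form\<close>).

  For the failure of \<open>F\<close>-purity the normal forms only serve to find a point at which \<open>h\<close> does not
  vanish. A pure
  homomorphism \<open>R \<rightarrow> S\<close> contracts \<open>tS\<close> to \<open>tR\<close>, which one sees by tensoring with \<open>R/tR\<close>
  (\<^emph>\<open>pure_hom_contracts_principal_ideal\<close>). In \<open>R = k[x,y]/(h)\<close> let \<open>t\<close> be a linear form that does not
  divide \<open>h\<close>. Then \<open>R/tR\<close> is \<open>k[l]/(l\<^sup>3)\<close> for a second linear form \<open>l\<close>, so \<open>l\<^sup>2\<close> is not in
  \<open>tR\<close>. On the other hand \<open>R/t\<^sup>pR\<close> is zero from degree \<open>p + 2\<close> on
  (\<^emph>\<open>form_in_power_ideal\<close>), and the Frobenius image \<open>l\<^bsup>2p\<^esup>\<close> of \<open>l\<^sup>2\<close> has degree \<open>2p \<ge> p + 2\<close>; so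
  it lies in \<open>t\<^sup>pR\<close>, and the Frobenius is not pure.\<close>


section \<open>Substitution and evaluation of binary polynomials\<close>

lemma poly_map_poly_hom:
  fixes \<phi> :: "'a::comm_ring_1 \<Rightarrow> 'b::comm_ring_1"
  assumes "\<phi> 0 = 0" and "\<And>x y. \<phi> (x + y) = \<phi> x + \<phi> y" and "\<And>x y. \<phi> (x * y) = \<phi> x * \<phi> y"
  shows "poly (map_poly \<phi> (p + q)) u = poly (map_poly \<phi> p) u + poly (map_poly \<phi> q) u"
    and "poly (map_poly \<phi> (p * q)) u = poly (map_poly \<phi> p) u * poly (map_poly \<phi> q) u"
proof -
  have add: "poly (map_poly \<phi> (p + q)) u = poly (map_poly \<phi> p) u + poly (map_poly \<phi> q) u" for p q
  proof -
    have "map_poly \<phi> (p + q) = map_poly \<phi> p + map_poly \<phi> q"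
      by (rule poly_eqI) (simp add: coeff_map_poly assms)
    then show ?thesis by simp
  qed
  show "poly (map_poly \<phi> (p + q)) u = poly (map_poly \<phi> p) u + poly (map_poly \<phi> q) u"
    by (rule add)
  show "poly (map_poly \<phi> (p * q)) u = poly (map_poly \<phi> p) u * poly (map_poly \<phi> q) u"
    by (induction p) (simp_all add: add map_poly_pCons map_poly_smult assms algebra_simps)
qed

lemma const2_hom [simp]:
  "const2 0 = 0" "const2 1 = 1" "const2 (a + b) = const2 a + const2 b"
  "const2 (a - b) = const2 a - const2 b" "const2 (- a) = - const2 a"
  "const2 (a * b) = const2 a * const2 b"
  by (simp_all add: const2_def one_pCons)

lemma subst2_add [simp]: "subst2 (f + g) u v = subst2 f u v + subst2 g u v"
  and subst2_mult [simp]: "subst2 (f * g) u v = subst2 f u v * subst2 g u v"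
  unfolding subst2_def
  by (rule poly_map_poly_hom; (rule poly_map_poly_hom)?; simp)+

lemma subst2_const2 [simp]: "subst2 (const2 c) u v = const2 c"
  by (simp add: subst2_def const2_def map_poly_pCons)

lemma subst2_varX [simp]: "subst2 varX u v = u"
  by (simp add: subst2_def varX_def map_poly_pCons)

lemma subst2_varY [simp]: "subst2 varY u v = v"
  by (simp add: subst2_def varY_def map_poly_pCons flip: one_pCons)

lemma subst2_1 [simp]: "subst2 1 u v = 1"
  using subst2_const2[of 1 u v] by simp

lemma subst2_power [simp]: "subst2 (f ^ n) u v = subst2 f u v ^ n"
  by (induction n) simp_all

lemma eval2_simps [simp]:
  "eval2 (f + g) a b = eval2 f a b + eval2 g a b"
  "eval2 (f - g) a b = eval2 f a b - eval2 g a b"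
  "eval2 (f * g) a b = eval2 f a b * eval2 g a b"
  "eval2 (f ^ n) a b = eval2 f a b ^ n"
  "eval2 (const2 c) a b = c" "eval2 varX a b = a" "eval2 varY a b = b"
  "eval2 0 a b = 0" "eval2 1 a b = 1"
  by (simp_all add: eval2_def const2_def varX_def varY_def)

lemma pCons_eq_var:
  "pCons a q = [:a:] + varY * q"
  "[:pCons c r:] = const2 c + varX * [:r:]"
  by (simp_all add: varX_def varY_def const2_def)

text \<open>Identities between ring homomorphisms on \<open>k[x,y]\<close> only have to be checked on constants and
  the two variables.\<close>

lemma binary_poly_induct [case_names const X Y add mult]:
  assumes "\<And>c. P (const2 c)" "P varX" "P varY"
    and add: "\<And>f g. P f \<Longrightarrow> P g \<Longrightarrow> P (f + g)" and mult: "\<And>f g. P f \<Longrightarrow> P g \<Longrightarrow> P (f * g)"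
  shows "P f"
proof -
  have univ: "P [:q:]" for q
  proof (induction q)
    case 0
    show ?case using assms(1)[of 0] by (simp add: const2_def)
  next
    case (pCons c r)
    then show ?case using pCons_eq_var(2)[of c r] assms by metis
  qed
  show ?thesis
  proof (induction f)
    case 0
    show ?case using univ[of 0] by simp
  next
    case (pCons a q)
    then show ?case using pCons_eq_var(1)[of a q] assms univ by metis
  qed
qed

lemma subst2_subst2:
  "subst2 (subst2 f u v) u' v' = subst2 f (subst2 u u' v') (subst2 v u' v')"
  by (induction f rule: binary_poly_induct) simp_all

lemma subst2_id: "subst2 f varX varY = f"
  by (induction f rule: binary_poly_induct) simp_all

lemma eval2_subst2: "eval2 (subst2 f u v) a b = eval2 f (eval2 u a b) (eval2 v a b)"
  by (induction f rule: binary_poly_induct) simp_all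


section \<open>Linear changes of coordinates\<close>

text \<open>Coordinate changes are composed and inverted through their rows, so a linear form is kept as a
  function of its coefficients.\<close>

definition lin :: "'a::comm_ring_1 \<Rightarrow> 'a \<Rightarrow> 'a poly poly" where
  "lin a b = const2 a * varX + const2 b * varY"

lemma lin_simps:
  "lin 1 0 = varX" "lin 0 1 = varY"
  "const2 c * lin a b = lin (c * a) (c * b)"
  "lin a b + lin c d = lin (a + c) (b + d)"
  by (simp_all add: lin_def algebra_simps)

lemma eval2_lin [simp]: "eval2 (lin a b) s u = a * s + b * u"
  by (simp add: lin_def)

lemma subst2_lin [simp]: "subst2 (lin a b) u v = const2 a * u + const2 b * v"
  by (simp add: lin_def)

lemma brought_to_lin:
  "brought_to h g \<longleftrightarrow>
     (\<exists>a b c d. a * d - b * c \<noteq> 0 \<and> subst2 h (lin a b) (lin c d) = g)"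
  by (simp add: brought_to_def lin_def)

text \<open>Being brought to is an equivalence relation: transitivity comes from the product of the two
  matrices, symmetry from the inverse matrix. So normal forms can be found by writing the form as a
  substitution instance of the normal form, and two normal forms of one cubic are equivalent.\<close>

lemma brought_to_trans:
  assumes "brought_to f g" "brought_to g h"
  shows "brought_to f h"
proof -
  from assms obtain a b c d a' b' c' d' where
    1: "a * d - b * c \<noteq> 0" "subst2 f (lin a b) (lin c d) = g" and
    2: "a' * d' - b' * c' \<noteq> 0" "subst2 g (lin a' b') (lin c' d') = h"
    by (auto simp: brought_to_lin)
  have "(a * a' + b * c') * (c * b' + d * d') - (a * b' + b * d') * (c * a' + d * c')
      = (a * d - b * c) * (a' * d' - b' * c')"
    by (simp add: algebra_simps)
  moreover have "subst2 f (lin (a * a' + b * c') (a * b' + b * d'))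
      (lin (c * a' + d * c') (c * b' + d * d')) = h"
    using 1(2) 2(2) by (auto simp: subst2_subst2 lin_simps)
  ultimately show ?thesis
    unfolding brought_to_lin using 1(1) 2(1) by (metis mult_eq_0_iff)
qed

lemma brought_to_sym:
  assumes "brought_to f g"
  shows "brought_to g f"
proof -
  from assms obtain a b c d where
    1: "a * d - b * c \<noteq> 0" "subst2 f (lin a b) (lin c d) = g"
    by (auto simp: brought_to_lin)
  define e where "e = a * d - b * c"
  have e: "e \<noteq> 0" using 1 by (simp add: e_def)
  have "(d / e) * (a / e) - (- b / e) * (- c / e) = e / (e * e)"
    using e by (simp add: e_def diff_divide_distrib algebra_simps)
  then have det: "(d / e) * (a / e) - (- b / e) * (- c / e) \<noteq> 0" using e by simp
  have *: "a * (d / e) + b * (- c / e) = 1" "a * (- b / e) + b * (a / e) = 0"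
    "c * (d / e) + d * (- c / e) = 0" "c * (- b / e) + d * (a / e) = 1"
    using e by (simp_all add: divide_simps) (simp_all add: e_def algebra_simps)
  have "subst2 g (lin (d / e) (- b / e)) (lin (- c / e) (a / e)) = f"
    unfolding 1(2)[symmetric] subst2_subst2 subst2_lin lin_simps * by (rule subst2_id)
  then show ?thesis unfolding brought_to_lin using det by blast
qed


section \<open>Binary forms\<close>

lemma is_form_simps [simp]:
  "is_form 0 (const2 c)" "is_form 0 1"
  "is_form (Suc 0) varX" "is_form (Suc 0) varY"
  by (auto simp: is_form_def const2_def varX_def varY_def coeff_pCons one_pCons split: nat.splits if_splits)

lemma is_form_add: "is_form n f \<Longrightarrow> is_form n g \<Longrightarrow> is_form n (f + g)"
  unfolding is_form_def by (metis coeff_add add_0)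

lemma is_form_mult:
  assumes "is_form m f" "is_form n g"
  shows "is_form (m + n) (f * g)"
  unfolding is_form_def
proof (intro allI impI)
  fix i j
  assume "coeff (coeff (f * g) j) i \<noteq> 0"
  then have "(\<Sum>b\<le>j. \<Sum>a\<le>i. coeff (coeff f b) a * coeff (coeff g (j - b)) (i - a)) \<noteq> 0"
    by (simp add: coeff_mult coeff_sum)
  then obtain b where "b \<le> j" "(\<Sum>a\<le>i. coeff (coeff f b) a * coeff (coeff g (j - b)) (i - a)) \<noteq> 0"
    by (metis (no_types, lifting) sum.neutral atMost_iff)
  moreover from this obtain a where "a \<le> i" "coeff (coeff f b) a * coeff (coeff g (j - b)) (i - a) \<noteq> 0"
    by (metis (no_types, lifting) sum.neutral atMost_iff)
  ultimately have "a + b = m" "(i - a) + (j - b) = n" "a \<le> i" "b \<le> j"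
    using assms unfolding is_form_def by (metis mult_zero_left mult_zero_right)+
  then show "i + j = m + n" by linarith
qed

lemma is_form_power: "is_form m f \<Longrightarrow> is_form (n * m) (f ^ n)"
  by (induction n) (auto intro: is_form_mult)

lemma is_form_const_mult: "is_form n f \<Longrightarrow> is_form n (const2 c * f)"
  using is_form_mult[of 0 "const2 c" n f] by simp

lemma is_form_lin: "is_form (Suc 0) (lin a b)"
  by (simp add: lin_def is_form_add is_form_const_mult)

lemma form_0: "is_form 0 f \<Longrightarrow> \<exists>c. f = const2 c"
proof -
  assume f: "is_form 0 f"
  have "f = const2 (coeff (coeff f 0) 0)"
    using f unfolding is_form_def const2_def
    by (intro poly_eqI) (auto simp: coeff_pCons split: nat.splits)
  then show ?thesis by blast
qed

text \<open>This decomposition is the source of an induction principle for forms, in which no coefficients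
  occur.\<close>

lemma form_Suc:
  assumes "is_form (Suc n) f"
  shows "\<exists>f1 f2. is_form n f1 \<and> is_form n f2 \<and> f = varX * f1 + varY * f2"
proof (cases f)
  case (pCons a q)
  have a: "i = Suc n" if "coeff a i \<noteq> 0" for i
  proof -
    have "coeff (coeff f 0) i \<noteq> 0" using that by (simp add: pCons)
    then have "i + 0 = Suc n" using assms unfolding is_form_def by blast
    then show ?thesis by simp
  qed
  have q: "is_form n q"
    unfolding is_form_def
  proof (intro allI impI)
    fix i j
    assume "coeff (coeff q j) i \<noteq> 0"
    then have "coeff (coeff f (Suc j)) i \<noteq> 0" by (simp add: pCons)
    then have "i + Suc j = Suc n" using assms unfolding is_form_def by blast
    then show "i + j = n" by simp
  qed
  have "a = pCons 0 (monom (coeff a (Suc n)) n)"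
    using a by (intro poly_eqI) (force simp: coeff_pCons split: nat.splits)
  then have "f = varX * [:monom (coeff a (Suc n)) n:] + varY * q"
    unfolding pCons pCons_eq_var(1)[of a q] by (simp add: varX_def)
  moreover have "is_form n [:monom (coeff a (Suc n)) n:]"
    by (auto simp: is_form_def coeff_pCons split: nat.splits if_splits)
  ultimately show ?thesis using q by blast
qed

lemma form_induct [consumes 1, case_names const step]:
  assumes "is_form n f" and "\<And>c. P 0 (const2 c)"
    and "\<And>n f g. is_form n f \<Longrightarrow> is_form n g \<Longrightarrow> P n f \<Longrightarrow> P n g \<Longrightarrow> P (Suc n) (varX * f + varY * g)"
  shows "P n f"
  using assms(1)
proof (induction n arbitrary: f)
  case 0
  then show ?case using form_0 assms(2) by metis
next
  case (Suc n)
  then show ?case using form_Suc[OF Suc.prems] assms(3) by metis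
qed

text \<open>With \<open>w = x\<close> this is the restriction of \<open>f\<close> to the line through \<open>(a, b)\<close>.\<close>

lemma subst2_form_line:
  assumes "is_form n f"
  shows "subst2 f (const2 a * w) (const2 b * w) = const2 (eval2 f a b) * w ^ n"
  using assms by (induction rule: form_induct) (simp_all add: algebra_simps)

lemma eval2_form_homogeneous:
  assumes "is_form n f"
  shows "eval2 f (t * a) (t * b) = t ^ n * eval2 f a b"
  using assms by (induction rule: form_induct) (simp_all add: algebra_simps)

text \<open>The linear forms \<open>l = \<alpha>x + \<beta>y\<close> and \<open>t = ux - sy\<close> take the values 1 and 0 at \<open>(s, u)\<close>, and they span
  the linear forms: \<open>x = sl + \<beta>t\<close> and \<open>y = ul - \<alpha>t\<close>. Hence modulo \<open>t\<close> every form of degree \<open>n\<close> is a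
  multiple of \<open>l\<^sup>n\<close>, and the factor is found by evaluation at \<open>(s, u)\<close>. In particular, a form that
  vanishes at \<open>(s, u)\<close> is divisible by \<open>t\<close>, and the cofactor is again a form. The latter lets the
  factorization be iterated without a change of coordinates.\<close>

lemma form_expand:
  fixes f :: "'a::comm_ring_1 poly poly"
  assumes "is_form (Suc n) f" and "\<alpha> * s + \<beta> * u = 1"
  shows "\<exists>g. is_form n g \<and>
    f = const2 (eval2 f s u) * lin \<alpha> \<beta> ^ Suc n + lin u (- s) * g"
proof -
  have 1: "const2 \<alpha> * const2 s + const2 \<beta> * const2 u = 1"
    using arg_cong[OF assms(2), of const2] by simp
  have "const2 s * lin \<alpha> \<beta> + const2 \<beta> * lin u (- s)
      = (const2 \<alpha> * const2 s + const2 \<beta> * const2 u) * varX"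
    "const2 u * lin \<alpha> \<beta> - const2 \<alpha> * lin u (- s)
      = (const2 \<alpha> * const2 s + const2 \<beta> * const2 u) * varY"
    by (simp_all add: lin_def algebra_simps)
  then have xy: "varX = const2 s * lin \<alpha> \<beta> + const2 \<beta> * lin u (- s)"
    "varY = const2 u * lin \<alpha> \<beta> - const2 \<alpha> * lin u (- s)"
    unfolding 1 by simp_all
  have split: "varX * p + varY * q = lin \<alpha> \<beta> * (const2 s * p + const2 u * q)
      + lin u (- s) * (const2 \<beta> * p + const2 (- \<alpha>) * q)" for p q
  proof -
    have "varX * p + varY * q = (const2 s * lin \<alpha> \<beta> + const2 \<beta> * lin u (- s)) * p
        + (const2 u * lin \<alpha> \<beta> - const2 \<alpha> * lin u (- s)) * q"
      by (simp only: xy[symmetric])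
    then show ?thesis by (simp add: algebra_simps)
  qed
  have "\<exists>g. is_form n g \<and> varX * f1 + varY * f2 =
      const2 (eval2 (varX * f1 + varY * f2) s u) * lin \<alpha> \<beta> ^ Suc n + lin u (- s) * g"
    if "is_form n f1" "is_form n f2" for n and f1 f2 :: "'a poly poly"
    using that
  proof (induction n arbitrary: f1 f2)
    case 0
    then obtain c d where cd: "f1 = const2 c" "f2 = const2 d" using form_0 by blast
    have ev: "eval2 (varX * f1 + varY * f2) s u = s * c + u * d" by (simp add: cd)
    show ?case
      unfolding ev unfolding split cd
      by (intro exI[of _ "const2 (\<beta> * c - \<alpha> * d)"] conjI is_form_simps(1)) (simp add: algebra_simps)
  next
    case (Suc n)
    let ?m = "const2 s * f1 + const2 u * f2"
    have "is_form (Suc n) ?m" by (intro is_form_add is_form_const_mult Suc.prems)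
    from form_Suc[OF this] Suc.IH obtain g where g: "is_form n g"
      "?m = const2 (eval2 ?m s u) * lin \<alpha> \<beta> ^ Suc n + lin u (- s) * g" by metis
    have "varX * f1 + varY * f2
        = lin \<alpha> \<beta> * ?m + lin u (- s) * (const2 \<beta> * f1 + const2 (- \<alpha>) * f2)"
      by (rule split)
    also have "\<dots> = const2 (eval2 ?m s u) * lin \<alpha> \<beta> ^ Suc (Suc n)
        + lin u (- s) * (lin \<alpha> \<beta> * g + (const2 \<beta> * f1 + const2 (- \<alpha>) * f2))"
    proof -
      have "lin \<alpha> \<beta> * ?m = lin \<alpha> \<beta> * (const2 (eval2 ?m s u) * lin \<alpha> \<beta> ^ Suc n + lin u (- s) * g)"
        using g(2) by (rule arg_cong)
      then show ?thesis by (simp only: distrib_left power_Suc mult_ac add_ac)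
    qed
    also have "eval2 ?m s u = eval2 (varX * f1 + varY * f2) s u" by simp
    finally have "varX * f1 + varY * f2 = const2 (eval2 (varX * f1 + varY * f2) s u) * lin \<alpha> \<beta> ^ Suc (Suc n)
        + lin u (- s) * (lin \<alpha> \<beta> * g + (const2 \<beta> * f1 + const2 (- \<alpha>) * f2))" .
    moreover have "is_form (Suc n) (lin \<alpha> \<beta> * g)"
      using is_form_mult[OF is_form_lin g(1)] by simp
    moreover have "is_form (Suc n) (const2 \<beta> * f1 + const2 (- \<alpha>) * f2)"
      by (intro is_form_add is_form_const_mult Suc.prems)
    ultimately show ?case using is_form_add by blast
  qed
  then show ?thesis using form_Suc[OF assms(1)] by metis
qed

lemma exists_lin_eq_1:
  fixes s u :: "'a::field"
  assumes "(s, u) \<noteq> (0, 0)"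
  shows "\<exists>\<alpha> \<beta>. \<alpha> * s + \<beta> * u = 1"
proof (cases "s = 0")
  case True
  then show ?thesis using assms by (intro exI[of _ 0] exI[of _ "1 / u"]) simp
next
  case False
  then show ?thesis by (intro exI[of _ "1 / s"] exI[of _ 0]) simp
qed

lemma degree_dehomogenize:
  assumes "is_form n f"
  shows "degree (poly f [:1:]) \<le> n"
  using assms
proof (induction rule: form_induct)
  case (step n f g)
  have "degree ([:0, 1:] * poly f [:1:] + poly g [:1:]) \<le> Suc n"
    using step by (intro degree_add_le order.trans[OF degree_mult_le]) auto
  then show ?case by (simp add: varX_def varY_def)
qed (simp add: const2_def)

text \<open>If \<open>(1, 0)\<close> is not a root, then \<open>f(x, 1)\<close> has the leading term \<open>f(1, 0) x\<^bsup>n+1\<^esup>\<close>, so it is a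
  nonconstant polynomial and has a root.\<close>

lemma form_has_root:
  fixes f :: "'a::alg_closed_field poly poly"
  assumes "is_form (Suc n) f"
  shows "\<exists>s u. (s, u) \<noteq> (0, 0) \<and> eval2 f s u = 0"
proof (cases "eval2 f 1 0 = 0")
  case True
  then show ?thesis by (intro exI[of _ 1] exI[of _ 0]) simp
next
  case False
  obtain g where g: "is_form n g"
    "f = const2 (eval2 f 1 0) * lin 1 0 ^ Suc n + lin 0 (- 1) * g"
    using form_expand[OF assms, of 1 1 0 0] by auto
  have "poly f [:1:] = [:eval2 f 1 0:] * [:0, 1:] ^ Suc n - poly g [:1:]"
    by (subst g(2)) (simp add: lin_def const2_def varX_def varY_def)
  then have "poly f [:1:] = monom (eval2 f 1 0) (Suc n) - poly g [:1:]"
    by (simp add: monom_altdef)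
  moreover have "coeff (poly g [:1:]) (Suc n) = 0"
    using degree_dehomogenize[OF g(1)] by (simp add: coeff_eq_0)
  ultimately have "coeff (poly f [:1:]) (Suc n) \<noteq> 0" using False by simp
  then have "degree (poly f [:1:]) > 0" using le_degree by fastforce
  then obtain s where "poly (poly f [:1:]) s = 0" using alg_closed_imp_poly_has_root by blast
  then show ?thesis by (intro exI[of _ s] exI[of _ 1]) (simp add: eval2_def)
qed

lemma form_splits_off_linear:
  fixes f :: "'a::alg_closed_field poly poly"
  assumes "is_form (Suc n) f"
  shows "\<exists>a b g. is_form n g \<and> f = lin a b * g"
proof -
  from form_has_root[OF assms] obtain s u where su: "(s, u) \<noteq> (0, 0)" "eval2 f s u = 0" by blast
  from exists_lin_eq_1[OF su(1)] obtain \<alpha> \<beta> where "\<alpha> * s + \<beta> * u = 1" by blast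
  from form_expand[OF assms this] su(2) show ?thesis by auto
qed

lemma cubic_form_splits:
  fixes h :: "'a::alg_closed_field poly poly"
  assumes "is_form 3 h"
  shows "\<exists>a b c d e f. h = lin a b * lin c d * lin e f"
proof -
  have "is_form (Suc 2) h" using assms by (simp add: numeral_3_eq_3)
  from form_splits_off_linear[OF this] obtain a b g where
    g: "is_form (Suc 1) g" "h = lin a b * g" by (auto simp: numeral_2_eq_2)
  from form_splits_off_linear[OF g(1)] obtain c d g' where
    g': "is_form (Suc 0) g'" "g = lin c d * g'" by auto
  from form_splits_off_linear[OF g'(1)] obtain e f k where
    k: "g' = lin e f * const2 k" using form_0 by blast
  have "h = lin a b * lin c d * lin (k * e) (k * f)"
    unfolding g g' k lin_simps(3)[symmetric] by (simp only: mult_ac)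
  then show ?thesis by blast
qed


section \<open>Normal forms of binary cubics\<close>

lemma brought_to_of_lin:
  assumes "a * d - b * c \<noteq> 0"
  shows "brought_to (subst2 g (lin a b) (lin c d)) g"
  by (rule brought_to_sym) (use assms in \<open>auto simp: brought_to_lin\<close>)

lemma lin_proportional:
  fixes a b c d :: "'a::field"
  assumes "a * d - b * c = 0" "(a, b) \<noteq> (0, 0)"
  shows "\<exists>k. lin c d = const2 k * lin a b"
proof (cases "a = 0")
  case True
  then show ?thesis using assms
    by (intro exI[of _ "d / b"]) (simp add: lin_simps(3) del: const2_hom)
next
  case False
  then have "d = c / a * b" using assms by (simp add: field_simps)
  then show ?thesis using False
    by (intro exI[of _ "c / a"]) (simp add: lin_simps(3) del: const2_hom)
qed

lemma lin_combination:
  fixes a b c d :: "'a::field"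
  assumes "a * d - b * c \<noteq> 0"
  shows "\<exists>p q. lin e f = const2 p * lin a b + const2 q * lin c d"
proof -
  define D where "D = a * d - b * c"
  have D: "D \<noteq> 0" using assms by (simp add: D_def)
  have "e * D = (e * d - f * c) * a + (f * a - e * b) * c"
    "f * D = (e * d - f * c) * b + (f * a - e * b) * d"
    by (simp_all add: D_def algebra_simps)
  then have "e = (e * d - f * c) / D * a + (f * a - e * b) / D * c"
    "f = (e * d - f * c) / D * b + (f * a - e * b) / D * d"
    using D by (simp_all add: divide_simps)
  then show ?thesis unfolding lin_simps by metis
qed

text \<open>With \<open>l\<close> and \<open>m\<close> independent, the third factor is \<open>pl + qm\<close>. If \<open>p\<close> or \<open>q\<close> is zero, the product has
  a double factor and the other factor absorbs the constant. Otherwise \<open>pl\<close>, \<open>qm\<close> and \<open>pl + qm\<close> are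
  the three factors of \<open>xy(x + y)\<close> in new coordinates; a cube root corrects the constant \<open>pq\<close>. Cube
  roots exist in every algebraically closed field, also in characteristic 3.\<close>

lemma independent_product_normal_form:
  fixes a b c d e f :: "'a::alg_closed_field"
  assumes det: "a * d - b * c \<noteq> 0" and nz: "lin e f \<noteq> 0"
  shows "brought_to (lin a b * lin c d * lin e f) (varX ^ 2 * varY) \<or>
    brought_to (lin a b * lin c d * lin e f) (varX * varY * (varX + varY))"
proof -
  obtain p q where pq: "lin e f = const2 p * lin a b + const2 q * lin c d"
    using lin_combination[OF det] by blast
  consider "q = 0" "p \<noteq> 0" | "p = 0" "q \<noteq> 0" | "p \<noteq> 0" "q \<noteq> 0"
    using nz pq by fastforce
  then show ?thesis
  proof cases
    case 1
    have "lin a b * lin c d * lin e f = subst2 (varX ^ 2 * varY) (lin a b) (lin (p * c) (p * d))"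
      unfolding pq 1 lin_simps(3)[symmetric] by (simp add: power2_eq_square mult_ac)
    moreover have "a * (p * d) - b * (p * c) \<noteq> 0"
      using det 1(2) by (simp add: mult.left_commute)
    ultimately show ?thesis using brought_to_of_lin by metis
  next
    case 2
    have "lin a b * lin c d * lin e f = subst2 (varX ^ 2 * varY) (lin c d) (lin (q * a) (q * b))"
      unfolding pq 2 lin_simps(3)[symmetric] by (simp add: power2_eq_square mult_ac)
    moreover have "c * (q * b) - d * (q * a) = - q * (a * d - b * c)" by (simp add: algebra_simps)
    then have "c * (q * b) - d * (q * a) \<noteq> 0" using det 2(2) by simp
    ultimately show ?thesis using brought_to_of_lin by metis
  next
    case 3
    obtain r where r: "r ^ 3 = 1 / (p * q)" using nth_root_exists[of 3 "1 / (p * q)"] by auto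
    then have r3: "r * r * r * p * q = 1" using 3 by (simp add: power3_eq_cube mult.assoc)
    then have "r \<noteq> 0" by auto
    \<comment> \<open>Scaling both coordinates by \<open>r\<close> multiplies the cubic by \<open>r\<^sup>3\<close>, which cancels \<open>pq\<close>.\<close>
    have "subst2 (varX * varY * (varX + varY)) (lin (r * p * a) (r * p * b)) (lin (r * q * c) (r * q * d))
        = const2 (r * r * r * p * q) * (lin a b * lin c d * lin e f)"
      unfolding pq lin_simps(3)[symmetric] by (simp add: algebra_simps)
    then have "lin a b * lin c d * lin e f
        = subst2 (varX * varY * (varX + varY)) (lin (r * p * a) (r * p * b)) (lin (r * q * c) (r * q * d))"
      unfolding r3 by simp
    moreover have "(r * p * a) * (r * q * d) - (r * p * b) * (r * q * c) = r * p * (r * q) * (a * d - b * c)"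
      by (simp add: algebra_simps)
    then have "(r * p * a) * (r * q * d) - (r * p * b) * (r * q * c) \<noteq> 0"
      using det 3 \<open>r \<noteq> 0\<close> by simp
    ultimately show ?thesis using brought_to_of_lin by metis
  qed
qed

text \<open>A product of three linear forms either contains two independent factors, which can be moved to
  the front, or is a constant times the cube of a linear form.\<close>

lemma cubic_normal_form:
  fixes h :: "'a::alg_closed_field poly poly"
  assumes "is_form 3 h" "h \<noteq> 0"
  shows "brought_to h (varX ^ 3) \<or> brought_to h (varX ^ 2 * varY) \<or>
    brought_to h (varX * varY * (varX + varY))"
proof -
  obtain a b c d e f where h: "h = lin a b * lin c d * lin e f"
    using cubic_form_splits[OF assms(1)] by blast
  have nz: "lin a b \<noteq> 0" "lin c d \<noteq> 0" "lin e f \<noteq> 0" using assms(2) h by auto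
  consider "a * d - b * c \<noteq> 0" | "a * f - b * e \<noteq> 0"
    | "a * d - b * c = 0" "a * f - b * e = 0" by blast
  then show ?thesis
  proof cases
    case 1
    then show ?thesis using independent_product_normal_form nz(3) h by blast
  next
    case 2
    have "h = lin a b * lin e f * lin c d" by (simp add: h mult_ac)
    then show ?thesis using independent_product_normal_form[OF 2 nz(2)] by auto
  next
    case 3
    have ab: "(a, b) \<noteq> (0, 0)" using nz(1) by (auto simp: lin_def)
    obtain k l where kl: "lin c d = const2 k * lin a b" "lin e f = const2 l * lin a b"
      using 3 lin_proportional[OF _ ab] by blast
    obtain r where "r ^ 3 = k * l" using nth_root_exists[of 3 "k * l"] by auto
    then have r: "r * (r * r) = k * l" by (simp add: power3_eq_cube mult.assoc)
    have "k * l \<noteq> 0" using nz kl by auto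
    then have "r \<noteq> 0" using r by auto
    \<comment> \<open>Any completion of the linear form to a coordinate system works; this one has determinant \<open>r\<close>.\<close>
    obtain s u where su: "s * a + u * b = 1" using exists_lin_eq_1[OF ab] by blast
    have "h = const2 (k * l) * lin a b ^ 3"
      by (simp add: h kl power3_eq_cube mult_ac)
    also have "\<dots> = subst2 (varX ^ 3) (lin (r * a) (r * b)) (lin (- u) s)"
      unfolding r[symmetric] lin_simps(3)[symmetric] by (simp add: power3_eq_cube mult_ac)
    finally have "h = subst2 (varX ^ 3) (lin (r * a) (r * b)) (lin (- u) s)" .
    moreover have "(r * a) * s - (r * b) * (- u) = r * (s * a + u * b)" by (simp add: algebra_simps)
    then have "(r * a) * s - (r * b) * (- u) \<noteq> 0" using su \<open>r \<noteq> 0\<close> by simp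
    ultimately show ?thesis using brought_to_of_lin by metis
  qed
qed


section \<open>Roots in the projective line\<close>

definition line :: "'a::field \<Rightarrow> 'a \<Rightarrow> ('a \<times> 'a) set" where
  "line a b = {(t * a, t * b) |t. True}"

lemma P1_eq: "P1 = {line a b |a b. (a, b) \<noteq> (0, 0)}"
  by (simp add: P1_def line_def)

lemma line_self: "(a, b) \<in> line a b"
  unfolding line_def by (auto intro!: exI[of _ 1])

lemma line_eq_iff:
  assumes "(a, b) \<noteq> (0, 0)" "(c, d) \<noteq> (0, 0)"
  shows "line a b = line c d \<longleftrightarrow> a * d = b * c"
proof
  assume "line a b = line c d"
  then obtain t where "a = t * c" "b = t * d" using line_self[of a b] by (auto simp: line_def)
  then show "a * d = b * c" by simp
next
  have "line a b \<subseteq> line c d"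
    if "a * d = b * c" "(a, b) \<noteq> (0, 0)" "(c, d) \<noteq> (0, 0)" for a b c d :: 'a
  proof (cases "c = 0")
    case True
    then have "d \<noteq> 0" "a = 0" using that by auto
    then have "t * a = (t * b / d) * c \<and> t * b = (t * b / d) * d" for t using True by simp
    then show ?thesis unfolding line_def by blast
  next
    case False
    then have "t * a = (t * a / c) * c \<and> t * b = (t * a / c) * d" for t
      using that by (simp add: field_simps)
    then show ?thesis unfolding line_def by blast
  qed
  from this[of a d b c] this[of c b d a] show "a * d = b * c \<Longrightarrow> line a b = line c d"
    using assms by (simp add: mult.commute subset_antisym)
qed

text \<open>By homogeneity, vanishing on a line through the origin is vanishing at one nonzero point of it.
  This makes the roots of a product the union of the roots of the factors.\<close>

lemma line_mem_roots:
  assumes "is_form n f" "(a, b) \<noteq> (0, 0)"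
  shows "line a b \<in> roots_P1 f \<longleftrightarrow> eval2 f a b = 0"
proof -
  have "line a b \<in> P1" using assms(2) by (auto simp: P1_eq)
  moreover have "(\<forall>(x, y)\<in>line a b. eval2 f x y = 0) \<longleftrightarrow> eval2 f a b = 0"
  proof
    assume "\<forall>(x, y)\<in>line a b. eval2 f x y = 0"
    then show "eval2 f a b = 0" using line_self[of a b] by blast
  next
    assume "eval2 f a b = 0"
    then have "eval2 f (t * a) (t * b) = 0" for t
      unfolding eval2_form_homogeneous[OF assms(1)] by simp
    then show "\<forall>(x, y)\<in>line a b. eval2 f x y = 0" by (auto simp: line_def)
  qed
  ultimately show ?thesis by (simp add: roots_P1_def)
qed

lemma roots_eq:
  assumes f: "is_form n f"
  shows "roots_P1 f = {line a b |a b. (a, b) \<noteq> (0, 0) \<and> eval2 f a b = 0}"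
proof (intro subset_antisym subsetI)
  fix L assume L: "L \<in> roots_P1 f"
  then obtain a b where ab: "L = line a b" "(a, b) \<noteq> (0, 0)"
    unfolding roots_P1_def P1_eq by blast
  then have "eval2 f a b = 0" using L line_mem_roots[OF f ab(2)] by simp
  then show "L \<in> {line a b |a b. (a, b) \<noteq> (0, 0) \<and> eval2 f a b = 0}" using ab by blast
next
  fix L assume "L \<in> {line a b |a b. (a, b) \<noteq> (0, 0) \<and> eval2 f a b = 0}"
  then obtain a b where "L = line a b" "(a, b) \<noteq> (0, 0)" "eval2 f a b = 0" by blast
  then show "L \<in> roots_P1 f" using line_mem_roots[OF f] by metis
qed

lemma roots_mult:
  fixes f g :: "'a::field poly poly"
  assumes "is_form m f" "is_form n g"
  shows "roots_P1 (f * g) = roots_P1 f \<union> roots_P1 g"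
proof -
  have "eval2 (f * g) a b = 0 \<longleftrightarrow> eval2 f a b = 0 \<or> eval2 g a b = 0" for a b by simp
  then show ?thesis
    unfolding roots_eq[OF assms(1)] roots_eq[OF assms(2)] roots_eq[OF is_form_mult[OF assms]]
    by blast
qed

lemma roots_lin:
  fixes a b :: "'a::field"
  assumes "(a, b) \<noteq> (0, 0)"
  shows "roots_P1 (lin a b) = {line b (- a)}"
proof -
  have ba: "(b, - a) \<noteq> (0, 0)" using assms by auto
  have iff: "eval2 (lin a b) s u = 0 \<longleftrightarrow> line s u = line b (- a)" if "(s, u) \<noteq> (0, 0)" for s u
  proof -
    have "eval2 (lin a b) s u = u * b - s * (- a)" by (simp add: mult.commute)
    then show ?thesis unfolding line_eq_iff[OF that ba] by (metis right_minus_eq)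
  qed
  show ?thesis
  proof (intro subset_antisym subsetI)
    fix L assume "L \<in> roots_P1 (lin a b)"
    then obtain s u where "L = line s u" "(s, u) \<noteq> (0, 0)" "eval2 (lin a b) s u = 0"
      unfolding roots_eq[OF is_form_lin] by blast
    then show "L \<in> {line b (- a)}" using iff by simp
  next
    fix L assume "L \<in> {line b (- a)}"
    then show "L \<in> roots_P1 (lin a b)"
      using iff[OF ba] line_mem_roots[OF is_form_lin ba] by simp
  qed
qed

lemma normal_forms_roots:
  "is_form 3 (varX ^ 3 :: 'a::field poly poly)" "card (roots_P1 (varX ^ 3 :: 'a poly poly)) = 1"
  "is_form 3 (varX ^ 2 * varY :: 'a poly poly)" "card (roots_P1 (varX ^ 2 * varY :: 'a poly poly)) = 2"
  "is_form 3 (varX * varY * (varX + varY) :: 'a poly poly)"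
  "card (roots_P1 (varX * varY * (varX + varY) :: 'a poly poly)) = 3"
proof -
  let ?x = "lin 1 0 :: 'a poly poly" and ?y = "lin 0 1 :: 'a poly poly" and ?z = "lin 1 1 :: 'a poly poly"
  have eqs: "varX ^ 3 = ?x * ?x * ?x" "varX ^ 2 * varY = ?x * ?x * ?y"
    "varX * varY * (varX + varY) = ?x * ?y * ?z"
    by (simp_all add: lin_def power3_eq_cube power2_eq_square)
  have f2: "is_form (Suc 0 + Suc 0) (lin a b * lin c d)" for a b c d :: 'a
    by (intro is_form_mult is_form_lin)
  have f3: "is_form 3 (lin a b * lin c d * lin e f)" for a b c d e f :: 'a
    using is_form_mult[OF f2 is_form_lin] by (simp add: numeral_3_eq_3)
  note r = roots_mult[OF f2 is_form_lin] roots_mult[OF is_form_lin is_form_lin]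
  show "is_form 3 (varX ^ 3 :: 'a poly poly)" "is_form 3 (varX ^ 2 * varY :: 'a poly poly)"
    "is_form 3 (varX * varY * (varX + varY) :: 'a poly poly)"
    unfolding eqs by (rule f3)+
  show "card (roots_P1 (varX ^ 3 :: 'a poly poly)) = 1"
    "card (roots_P1 (varX ^ 2 * varY :: 'a poly poly)) = 2"
    "card (roots_P1 (varX * varY * (varX + varY) :: 'a poly poly)) = 3"
    unfolding eqs r by (simp_all add: roots_lin line_eq_iff card_insert_if)
qed

text \<open>The lines through \<open>(1, c)\<close> are distinct, so it is enough that the field is infinite: over a finite
  field, \<open>1 + \<Prod>(x - c)\<close> would have no root.\<close>

lemma infinite_P1: "infinite (P1 :: ('a::alg_closed_field \<times> 'a) set set)"
proof
  assume fin: "finite (P1 :: ('a \<times> 'a) set set)"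
  have "inj (\<lambda>c :: 'a. line 1 c)"
    by (rule injI) (simp add: line_eq_iff)
  moreover have "range (\<lambda>c :: 'a. line 1 c) \<subseteq> P1"
  proof (rule image_subsetI)
    show "line 1 c \<in> P1" for c :: 'a
      unfolding P1_eq by (intro CollectI exI conjI) (rule refl, simp)
  qed
  ultimately have fin: "finite (UNIV :: 'a set)" using fin finite_subset finite_imageD by metis
  define p :: "'a poly" where "p = (\<Prod>c\<in>UNIV. [:- c, 1:])"
  have "degree p = card (UNIV :: 'a set)"
    unfolding p_def by (subst degree_prod_eq_sum_degree) auto
  then have "degree (p + 1) > 0"
    using fin by (subst degree_add_eq_left) (auto simp: card_gt_0_iff)
  then obtain c where "poly (p + 1) c = 0" using alg_closed_imp_poly_has_root by blast
  moreover have "poly p c = 0" unfolding p_def poly_prod using fin by (intro prod_zero) auto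
  ultimately show False by simp
qed

text \<open>An invertible coordinate change permutes the projective line and carries the roots of \<open>g\<close> to those
  of \<open>f\<close>. The number of roots therefore separates the normal forms.\<close>

lemma card_roots_brought_to:
  fixes f g :: "'a::field poly poly"
  assumes "brought_to f g"
  shows "card (roots_P1 f) = card (roots_P1 g)"
proof -
  from assms obtain a b c d where
    det: "a * d - b * c \<noteq> 0" and g: "subst2 f (lin a b) (lin c d) = g"
    by (auto simp: brought_to_lin)
  define A where "A = (\<lambda>(x, y). (a * x + b * y, c * x + d * y))"
  define D where "D = a * d - b * c"
  define B where "B = (\<lambda>(x, y). ((d * x - b * y) / D, (a * y - c * x) / D))"
  have D: "D \<noteq> 0" using det by (simp add: D_def)
  have BA: "B (A z) = z" for z
    using D by (cases z) (simp add: A_def B_def divide_simps, simp add: D_def algebra_simps)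
  have AB: "A (B z) = z" for z
    using D by (cases z) (simp add: A_def B_def divide_simps, simp add: D_def algebra_simps)
  have A0: "A z = (0, 0) \<longleftrightarrow> z = (0, 0)" for z
    using BA[of z] by (auto simp: A_def B_def split: prod.splits)
  have P1: "F ` L \<in> P1"
    if "L \<in> P1" and F0: "\<And>z. F z = (0, 0) \<longleftrightarrow> z = (0, 0)"
      and F: "\<And>t x y. F (t * x, t * y) = (t * fst (F (x, y)), t * snd (F (x, y)))"
    for F :: "'a \<times> 'a \<Rightarrow> 'a \<times> 'a" and L
  proof -
    from \<open>L \<in> P1\<close> obtain x y where L: "L = line x y" "(x, y) \<noteq> (0, 0)" unfolding P1_eq by blast
    have "F ` L = line (fst (F (x, y))) (snd (F (x, y)))"
    proof -
      have "F ` line x y = {F (t * x, t * y) |t. True}" unfolding line_def by blast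
      then show ?thesis unfolding L F by (simp only: line_def)
    qed
    moreover have "(fst (F (x, y)), snd (F (x, y))) \<noteq> (0, 0)" using F0[of "(x, y)"] L(2) by simp
    ultimately show ?thesis unfolding P1_eq by blast
  qed
  have AP1: "A ` L \<in> P1" if "L \<in> P1" for L
    by (rule P1[OF that A0]) (simp add: A_def algebra_simps)
  have B0: "B z = (0, 0) \<longleftrightarrow> z = (0, 0)" for z
    using A0[of "B z"] by (simp add: AB)
  have BP1: "B ` L \<in> P1" if "L \<in> P1" for L
    by (rule P1[OF that B0]) (simp add: B_def algebra_simps diff_divide_distrib)
  have ev: "eval2 g x y = eval2 f (fst (A (x, y))) (snd (A (x, y)))" for x y
    unfolding g[symmetric] eval2_subst2 by (simp add: A_def)
  have "bij_betw ((`) A) (roots_P1 g) (roots_P1 f)"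
  proof (rule bij_betw_byWitness[where f' = "(`) B"])
    show "\<forall>L\<in>roots_P1 g. B ` A ` L = L" by (simp add: image_image BA)
    show "\<forall>L\<in>roots_P1 f. A ` B ` L = L" by (simp add: image_image AB)
    have "A ` L \<in> roots_P1 f" if "L \<in> roots_P1 g" for L
      using that AP1[of L] unfolding roots_P1_def by (auto simp: ev split_beta)
    then show "(`) A ` roots_P1 g \<subseteq> roots_P1 f" by blast
    have "B ` L \<in> roots_P1 g" if "L \<in> roots_P1 f" for L
      using that BP1[of L] unfolding roots_P1_def by (auto simp: ev AB split_beta)
    then show "(`) B ` roots_P1 f \<subseteq> roots_P1 g" by blast
  qed
  then show ?thesis by (metis bij_betw_same_card)
qed

lemma cubic_with_three_distinct_roots_normal_form:
  fixes g :: "'a::alg_closed_field poly poly"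
  assumes "cubic_with_three_distinct_roots g"
  shows "brought_to g (varX * varY * (varX + varY))"
proof -
  have g: "is_form 3 g" "card (roots_P1 g) = 3"
    using assms by (simp_all add: cubic_with_three_distinct_roots_def)
  have "roots_P1 (0 :: 'a poly poly) = P1" by (auto simp: roots_P1_def)
  then have "g \<noteq> 0" using g(2) infinite_P1[where 'a = 'a] by auto
  moreover have "\<not> brought_to g (varX ^ 3)" "\<not> brought_to g (varX ^ 2 * varY)"
    using card_roots_brought_to[of g] g(2) normal_forms_roots(2,4)[where 'a = 'a] by auto
  ultimately show ?thesis using cubic_normal_form[OF g(1)] by blast
qed

lemma unique_normal_form:
  fixes g h :: "'a::alg_closed_field poly poly"
  assumes h: "is_form 3 h" "h \<noteq> 0" and g: "cubic_with_three_distinct_roots g"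
  shows "\<exists>!i. i < 3 \<and> brought_to h ([varX ^ 3, varX ^ 2 * varY, g] ! i)"
proof -
  let ?N = "[varX ^ 3, varX ^ 2 * varY, g]"
  have "brought_to (varX * varY * (varX + varY)) g"
    using cubic_with_three_distinct_roots_normal_form[OF g] by (rule brought_to_sym)
  then have "brought_to h (?N ! 0) \<or> brought_to h (?N ! 1) \<or> brought_to h (?N ! 2)"
    using cubic_normal_form[OF h] brought_to_trans by auto
  moreover have "(0 :: nat) < 3" "(1 :: nat) < 3" "(2 :: nat) < 3" by simp_all
  ultimately have ex: "\<exists>i<3. brought_to h (?N ! i)" by blast
  have card: "card (roots_P1 (?N ! i)) = Suc i" if "i < 3" for i
  proof -
    have "i = 0 \<or> i = 1 \<or> i = 2" using that by auto
    then show ?thesis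
      using g normal_forms_roots(2,4)[where 'a = 'a] by (auto simp: cubic_with_three_distinct_roots_def)
  qed
  have "i = j" if "i < 3" "brought_to h (?N ! i)" "j < 3" "brought_to h (?N ! j)" for i j
    using card[of i] card[of j] card_roots_brought_to[of h] that by (metis Suc_inject)
  with ex show ?thesis by blast
qed

text \<open>A nonzero cubic has at most three roots, while the projective line is infinite.\<close>

lemma exists_nonroot:
  fixes h :: "'a::alg_closed_field poly poly"
  assumes "is_form 3 h" "h \<noteq> 0"
  shows "\<exists>s u. (s, u) \<noteq> (0, 0) \<and> eval2 h s u \<noteq> 0"
proof -
  have "card (roots_P1 h) > 0"
    using cubic_normal_form[OF assms] card_roots_brought_to[of h] normal_forms_roots(2,4,6)[where 'a = 'a]
    by fastforce
  then have "roots_P1 h \<noteq> P1" using infinite_P1[where 'a = 'a] by (metis card.infinite less_irrefl)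
  then show ?thesis
    unfolding roots_eq[OF assms(1)] P1_eq by blast
qed


section \<open>Purity and contraction of ideals\<close>

lemma module_module_via:
  assumes R: "cring R" and S: "cring S" and \<psi>: "\<psi> \<in> ring_hom R S"
  shows "module R (module_via \<psi> S)"
proof -
  interpret R: cring R by fact
  interpret S: cring S by fact
  have "abelian_group (module_via \<psi> S)"
    using S.l_neg S.a_inv_closed
    by (intro abelian_groupI) (auto simp: module_via_def S.a_ac)
  then show ?thesis
    using \<psi>
    by (intro moduleI R)
      (auto simp: module_via_def ring_hom_closed ring_hom_add ring_hom_mult ring_hom_one
        S.l_distr S.r_distr S.m_assoc)
qed

text \<open>The element \<open>1 \<otimes> rm\<close> of \<open>R \<otimes> M\<close> is mapped to \<open>1 \<otimes> rm = \<phi>(r) \<otimes> m = \<phi>(t)s \<otimes> m = s \<otimes> tm = 0\<close> in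
  \<open>S \<otimes> M\<close>. Purity gives \<open>1 \<otimes> rm = 0\<close> in \<open>R \<otimes> M\<close>, and the isomorphism \<open>R \<otimes> M \<cong> M\<close> turns this into
  \<open>rm = 0\<close>.\<close>

lemma pure_on_cancels_annihilator:
  fixes R :: "'r ring" and S :: "'s ring" and M :: "('r, 'm) module"
  assumes R: "cring R" and S: "cring S" and \<phi>: "\<phi> \<in> ring_hom R S"
    and pure: "pure_on TYPE('m) R S \<phi>" and M: "module R M"
    and m: "m \<in> carrier M" and r: "r \<in> carrier R" and t: "t \<in> carrier R" and s: "s \<in> carrier S"
    and tm: "t \<odot>\<^bsub>M\<^esub> m = \<zero>\<^bsub>M\<^esub>" and rt: "\<phi> r = \<phi> t \<otimes>\<^bsub>S\<^esub> s"
  shows "r \<odot>\<^bsub>M\<^esub> m = \<zero>\<^bsub>M\<^esub>"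
proof -
  interpret R: cring R by fact
  interpret S: cring S by fact
  interpret M: module R M by fact
  let ?K = "tensor_subgroup R (module_via id R) M"
  let ?K' = "tensor_subgroup R (module_via \<phi> S) M"
  have clR: "closed_ops R (module_via id R)"
    by (auto simp: closed_ops_def module_via_def)
  have clS: "closed_ops R (module_via \<phi> S)"
    using \<phi> by (auto simp: closed_ops_def module_via_def ring_hom_closed)
  note K' = tensor_subgroup_closed[OF clS M.closed_ops_self]
  note \<phi>_simps = ring_hom_one[OF \<phi>] ring_hom_closed[OF \<phi>]
  have move: "frag_of (\<phi> a \<otimes>\<^bsub>S\<^esub> x, y) - frag_of (x, a \<odot>\<^bsub>M\<^esub> y) \<in> ?K'"
    if "a \<in> carrier R" "x \<in> carrier S" "y \<in> carrier M" for a x y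
    by (rule K'(5)) (use that in \<open>auto simp: tensor_relations_def module_via_def\<close>)
  have zero: "frag_of (x, \<zero>\<^bsub>M\<^esub>) \<in> ?K'" if x: "x \<in> carrier S" for x
  proof -
    have "frag_of (x, \<zero>\<^bsub>M\<^esub> \<oplus>\<^bsub>M\<^esub> \<zero>\<^bsub>M\<^esub>) - frag_of (x, \<zero>\<^bsub>M\<^esub>) - frag_of (x, \<zero>\<^bsub>M\<^esub>)
        \<in> tensor_relations R (module_via \<phi> S) M"
      unfolding tensor_relations_def
      by (rule UnI1, rule UnI2, rule CollectI, intro exI conjI, rule refl)
        (simp_all add: module_via_def x)
    then have "- frag_of (x, \<zero>\<^bsub>M\<^esub>) \<in> ?K'" by (intro K'(5)) simp
    from K'(3)[OF this] show ?thesis by simp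
  qed
  have "frag_of (\<phi> r, m) - frag_of (\<one>\<^bsub>S\<^esub>, r \<odot>\<^bsub>M\<^esub> m) \<in> ?K'"
    using move[OF r S.one_closed m] r \<phi>_simps by simp
  moreover have "frag_of (\<phi> r, m) \<in> ?K'"
    using K'(2)[OF move[OF t s m] zero[OF s]] by (simp add: rt tm)
  ultimately have "frag_of (\<phi> r, m) - (frag_of (\<phi> r, m) - frag_of (\<one>\<^bsub>S\<^esub>, r \<odot>\<^bsub>M\<^esub> m)) \<in> ?K'"
    using K'(4) by blast
  then have "frag_of (\<one>\<^bsub>S\<^esub>, r \<odot>\<^bsub>M\<^esub> m) \<in> ?K'"
    by (simp only: diff_diff_eq2 add_diff_cancel_left')
  then have "frag_map (map_prod \<phi> id) (frag_of (\<one>\<^bsub>R\<^esub>, r \<odot>\<^bsub>M\<^esub> m)) \<in> ?K'"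
    by (simp add: \<phi>_simps)
  moreover have "Poly_Mapping.keys (frag_of (\<one>\<^bsub>R\<^esub>, r \<odot>\<^bsub>M\<^esub> m)) \<subseteq> carrier R \<times> carrier M"
    using r m by simp
  ultimately have K: "frag_of (\<one>\<^bsub>R\<^esub>, r \<odot>\<^bsub>M\<^esub> m) \<in> ?K"
    using pure[unfolded pure_on_iff[OF R S \<phi>]] M by blast
  \<comment> \<open>The action \<open>a \<otimes> x \<mapsto> ax\<close>, lifted to the free Abelian group, kills the bilinearity relations.\<close>
  let ?G = "add_monoid M"
  let ?F = "free_Abelian_group (carrier R \<times> carrier M)"
  have "(\<lambda>(a, x). a \<odot>\<^bsub>M\<^esub> x) ` (carrier R \<times> carrier M) \<subseteq> carrier ?G" by auto
  then obtain \<mu> where \<mu>: "\<mu> \<in> hom ?F ?G"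
    and \<mu>_of: "\<And>z. z \<in> carrier R \<times> carrier M \<Longrightarrow> \<mu> (frag_of z) = (\<lambda>(a, x). a \<odot>\<^bsub>M\<^esub> x) z"
    by (rule comm_group.free_Abelian_group_universal[OF M.a_comm_group]) blast
  interpret \<mu>: group_hom ?F ?G \<mu>
    by (simp add: \<mu> group_hom_def group_hom_axioms_def M.add.is_group)
  have carR: "carrier (module_via id R) = carrier R" by (simp add: module_via_def)
  have diff_closed: "a - b \<in> carrier ?F" if "a \<in> carrier ?F" "b \<in> carrier ?F" for a b
    using that keys_diff[of a b] by auto
  have diff: "\<mu> (a - b) = \<mu> a \<ominus>\<^bsub>M\<^esub> \<mu> b" if "a \<in> carrier ?F" "b \<in> carrier ?F" for a b
  proof -
    have ab: "a - b \<in> carrier ?F" using that by (rule diff_closed)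
    have cl: "\<mu> a \<in> carrier M" "\<mu> b \<in> carrier M" "\<mu> (a - b) \<in> carrier M"
      using \<mu>.hom_closed[OF that(1)] \<mu>.hom_closed[OF that(2)] \<mu>.hom_closed[OF ab] by auto
    have "\<mu> (a - b) \<oplus>\<^bsub>M\<^esub> \<mu> b = \<mu> a"
      using \<mu>.hom_mult[OF ab that(2)] by simp
    then show ?thesis using cl by (metis M.add.inv_solve_right a_minus_def)
  qed
  have diff2: "\<mu> (frag_of x - frag_of y - frag_of z) = \<mu> (frag_of x) \<ominus>\<^bsub>M\<^esub> \<mu> (frag_of y) \<ominus>\<^bsub>M\<^esub> \<mu> (frag_of z)"
    if "{x, y, z} \<subseteq> carrier R \<times> carrier M" for x y z
  proof -
    have "frag_of x \<in> carrier ?F" "frag_of y \<in> carrier ?F" "frag_of z \<in> carrier ?F"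
      using that by simp_all
    then show ?thesis by (simp only: diff diff_closed)
  qed
  have "tensor_relations R (module_via id R) M \<subseteq> kernel ?F ?G \<mu>"
  proof
    fix c assume c: "c \<in> tensor_relations R (module_via id R) M"
    have "c \<in> carrier ?F"
      using c tensor_relations_subset[OF clR M.closed_ops_self] unfolding carR by blast
    moreover have "\<mu> c = \<zero>\<^bsub>M\<^esub>"
      using c unfolding tensor_relations_def
    proof (elim UnE CollectE exE conjE)
      fix a a' x
      assume "c = frag_of (a \<oplus>\<^bsub>module_via id R\<^esub> a', x) - frag_of (a, x) - frag_of (a', x)"
        "a \<in> carrier (module_via id R)" "a' \<in> carrier (module_via id R)" "x \<in> carrier M"
      then show ?thesis
        by (simp add: module_via_def diff2 \<mu>_of M.smult_l_distr M.minus_eq)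
          (simp add: M.minus_add M.a_ac M.r_neg)
    next
      fix a x x'
      assume "c = frag_of (a, x \<oplus>\<^bsub>M\<^esub> x') - frag_of (a, x) - frag_of (a, x')"
        "a \<in> carrier (module_via id R)" "x \<in> carrier M" "x' \<in> carrier M"
      then show ?thesis
        by (simp add: module_via_def diff2 \<mu>_of M.smult_r_distr M.minus_eq)
          (simp add: M.minus_add M.a_ac M.r_neg)
    next
      fix a b x
      assume "c = frag_of (a \<odot>\<^bsub>module_via id R\<^esub> b, x) - frag_of (b, a \<odot>\<^bsub>M\<^esub> x)"
        "a \<in> carrier R" "b \<in> carrier (module_via id R)" "x \<in> carrier M"
      then show ?thesis
        by (simp add: module_via_def diff \<mu>_of R.m_comm[of a b] M.smult_assoc1 M.minus_eq M.r_neg)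
    qed
    ultimately show "c \<in> kernel ?F ?G \<mu>" by (simp add: kernel_def)
  qed
  then have "?K \<subseteq> kernel ?F ?G \<mu>"
    using \<mu>.G.generate_subgroup_incl[OF _ \<mu>.subgroup_kernel]
    unfolding tensor_subgroup_def carR by blast
  then have "\<mu> (frag_of (\<one>\<^bsub>R\<^esub>, r \<odot>\<^bsub>M\<^esub> m)) = \<zero>\<^bsub>M\<^esub>" using K by (auto simp: kernel_def)
  then show ?thesis using \<mu>_of[of "(\<one>\<^bsub>R\<^esub>, r \<odot>\<^bsub>M\<^esub> m)"] r m by simp
qed

text \<open>The previous lemma for the module \<open>R/tR\<close> and its generator, whose annihilator is \<open>tR\<close>.\<close>

lemma pure_hom_contracts_principal_ideal:
  fixes R :: "'r ring" and S :: "'s ring"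
  assumes R: "cring R" and S: "cring S" and \<phi>: "\<phi> \<in> ring_hom R S" and pure: "pure_hom R S \<phi>"
    and r: "r \<in> carrier R" and t: "t \<in> carrier R" and rt: "\<phi> r \<in> PIdl\<^bsub>S\<^esub> (\<phi> t)"
  shows "r \<in> PIdl\<^bsub>R\<^esub> t"
proof -
  interpret R: cring R by fact
  interpret S: cring S by fact
  let ?J = "PIdl\<^bsub>R\<^esub> t"
  interpret J: ideal ?J R by (rule R.cgenideal_ideal[OF t])
  let ?Q = "R Quot ?J" and ?\<pi> = "(+>\<^bsub>R\<^esub>) ?J"
  have Q: "cring ?Q" by (rule J.quotient_is_cring[OF R])
  interpret Q: cring ?Q by (rule Q)
  have \<pi>: "?\<pi> \<in> ring_hom R ?Q" by (rule J.rcos_ring_hom)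
  let ?M = "module_via ?\<pi> ?Q"
  have act: "a \<odot>\<^bsub>?M\<^esub> \<one>\<^bsub>?Q\<^esub> = ?\<pi> a" if "a \<in> carrier R" for a
    using ring_hom_closed[OF \<pi> that] by (simp add: module_via_def)
  have zero: "\<zero>\<^bsub>?M\<^esub> = ?J" by (simp add: module_via_def FactRing_def)
  from rt obtain s where s: "s \<in> carrier S" "\<phi> r = \<phi> t \<otimes>\<^bsub>S\<^esub> s"
    using ring_hom_closed[OF \<phi> t] S.m_comm unfolding cgenideal_def by auto
  have "?\<pi> t = ?J" using R.cgenideal_self[OF t] R.a_rcos_zero J.ideal_axioms by blast
  then have "t \<odot>\<^bsub>?M\<^esub> \<one>\<^bsub>?Q\<^esub> = \<zero>\<^bsub>?M\<^esub>" by (simp add: act[OF t] zero)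
  moreover have "\<one>\<^bsub>?Q\<^esub> \<in> carrier ?M" by (simp add: module_via_def)
  ultimately have "r \<odot>\<^bsub>?M\<^esub> \<one>\<^bsub>?Q\<^esub> = \<zero>\<^bsub>?M\<^esub>"
    using pure_on_cancels_annihilator[OF R S \<phi> pure_hom_imp_pure_on[OF R S \<phi> pure]
        module_module_via[OF R Q \<pi>] _ r t s(1) _ s(2)] by blast
  then have "?\<pi> r = ?J" by (simp add: act[OF r] zero)
  then show ?thesis using J.rcos_const_imp_mem[OF r] by blast
qed


section \<open>Quotients of a polynomial ring by a form of large degree\<close>

text \<open>The quotient of \<open>k[x,y]\<close> by \<open>t\<^sup>n\<close> and \<open>h\<close>, for a linear form \<open>t\<close> that does not divide \<open>h\<close>, is zero
  from degree \<open>n + d - 1\<close> on. Indeed, modulo \<open>t\<close> every form of degree at least \<open>d\<close> is a multiple of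
  \<open>h\<close>, because there every form is a constant times a power of \<open>l\<close>, and the constant of
  \<open>h\<close> is its nonzero value at \<open>(s, u)\<close>; subtracting this multiple leaves \<open>t\<close> times a form of
  degree one less.\<close>

lemma form_in_power_ideal:
  fixes h :: "'a::field poly poly"
  assumes h: "is_form d h" "eval2 h s u \<noteq> 0" and su: "\<alpha> * s + \<beta> * u = 1" and d: "d > 0"
    and f: "is_form (n + d - 1) f"
  shows "\<exists>a b. f = a * lin u (- s) ^ n + b * h"
  using f
proof (induction n arbitrary: f)
  case 0
  then show ?case by (intro exI[of _ f] exI[of _ 0]) simp
next
  case (Suc n)
  define k where "k = eval2 f s u / eval2 h s u"
  have deg: "Suc (n + d - 1) = n + d" using d by simp
  have f: "is_form (n + d) f" using Suc.prems by simp
  have form: "is_form (Suc (n + d - 1)) (f + const2 (- k) * (lin \<alpha> \<beta> ^ n * h))"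
    unfolding deg using is_form_mult[OF is_form_power[OF is_form_lin, of n] h(1)]
    by (intro is_form_add is_form_const_mult f) simp
  have "eval2 (f + const2 (- k) * (lin \<alpha> \<beta> ^ n * h)) s u = 0"
    using h(2) su by (simp add: k_def)
  with form_expand[OF form su] obtain g where
    g: "is_form (n + d - 1) g" "f + const2 (- k) * (lin \<alpha> \<beta> ^ n * h) = lin u (- s) * g" by auto
  from Suc.IH[OF g(1)] obtain a b where ab: "g = a * lin u (- s) ^ n + b * h" by blast
  have "f = lin u (- s) * g + const2 k * (lin \<alpha> \<beta> ^ n * h)"
    using g(2) by (simp add: algebra_simps)
  also have "\<dots> = a * lin u (- s) ^ Suc n + (lin u (- s) * b + const2 k * lin \<alpha> \<beta> ^ n) * h"
    by (simp add: ab algebra_simps)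
  finally show ?case by blast
qed


section \<open>Quotients by binary forms and the Frobenius\<close>

lemma pow_ring_of_type_algebra:
  "a [^]\<^bsub>ring_of_type_algebra\<^esub> n = (a :: 'a::comm_ring_1) ^ (n :: nat)"
  by (induction n) (simp_all add: ring_of_type_algebra_def nat_pow_def mult.commute)

text \<open>Let \<open>t\<close> be the linear form that vanishes at \<open>(s, u)\<close>, and \<open>l\<close> one with value 1 there. In the
  quotient \<open>R\<close> by \<open>h\<close>, the power \<open>l\<^bsup>d-1\<^esup>\<close> is not in \<open>tR\<close>: restricted to the line through \<open>(s, u)\<close> it has
  degree \<open>d - 1\<close>, while \<open>t\<close> vanishes and \<open>h\<close> has degree \<open>d\<close>. But its \<open>p\<close>-th power is a form of
  degree \<open>p(d - 1) \<ge> p + d - 1\<close>, so it lies in \<open>t\<^sup>pR\<close> by the previous lemma. The Frobenius would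
  contract \<open>t\<^sup>pR\<close> to \<open>tR\<close> if it were pure. The condition \<open>d \<ge> 3\<close> enters through the inequality of the
  degrees, which for \<open>d = 2\<close> fails for every \<open>p\<close>.\<close>

lemma not_F_pure_quotient_by_form:
  fixes h :: "'a::field poly poly"
  assumes h: "is_form d h" "d \<ge> 3" and su: "(s, u) \<noteq> (0, 0)" "eval2 h s u \<noteq> 0"
    and char: "CHAR('a) > 0"
  shows "\<not> F_pure CHAR('a) (quotient_ring2 h)"
proof
  assume pure: "F_pure CHAR('a) (quotient_ring2 h)"
  define p where "p = CHAR('a)"
  have p: "Factorial_Ring.prime p" unfolding p_def by (rule prime_CHAR_semidom[OF char])
  then have p2: "p \<ge> 2" by (rule prime_ge_2_nat)
  let ?P = "ring_of_type_algebra :: 'a poly poly ring"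
  interpret P: cring ?P by (rule cring_from_type_algebra)
  have P_simps: "carrier ?P = UNIV" "x \<otimes>\<^bsub>?P\<^esub> y = x * y" "x \<oplus>\<^bsub>?P\<^esub> y = x + y" "\<zero>\<^bsub>?P\<^esub> = 0" for x y
    by (simp_all add: ring_of_type_algebra_def)
  have minus: "x \<ominus>\<^bsub>?P\<^esub> y = x - y" for x y
    using P.add.inv_solve_right'[of "x - y" x y] by (simp add: P_simps P.minus_eq)
  let ?J = "PIdl\<^bsub>?P\<^esub> h"
  have J_iff: "x \<in> ?J \<longleftrightarrow> h dvd x" for x
    by (auto simp: cgenideal_def P_simps dvd_def mult.commute)
  interpret J: ideal ?J ?P by (rule P.cgenideal_ideal) (simp add: P_simps)
  define R where "R = ?P Quot ?J"
  define \<pi> where "\<pi> = (+>\<^bsub>?P\<^esub>) ?J"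
  have R: "cring R" unfolding R_def by (rule J.quotient_is_cring) (rule P.is_cring)
  interpret R: cring R by (rule R)
  interpret \<pi>: ring_hom_ring ?P R \<pi> unfolding R_def \<pi>_def by (rule J.rcos_ring_hom_ring)
  have \<pi>_eq_iff: "\<pi> x = \<pi> y \<longleftrightarrow> h dvd x - y" for x y
    unfolding \<pi>_def
    using P.quotient_eq_iff_same_a_r_cos[OF J.ideal_axioms, of x y] by (simp add: P_simps minus J_iff)
  have \<pi>_surj: "\<exists>f. x = \<pi> f" if "x \<in> carrier R" for x
    using that by (auto simp: R_def \<pi>_def FactRing_def A_RCOSETS_def' P_simps)
  have \<pi>_simps: "\<pi> x \<in> carrier R" "\<pi> x \<otimes>\<^bsub>R\<^esub> \<pi> y = \<pi> (x * y)" "\<pi> x \<oplus>\<^bsub>R\<^esub> \<pi> y = \<pi> (x + y)"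
    "\<pi> x [^]\<^bsub>R\<^esub> n = \<pi> (x ^ n)" for x y and n :: nat
    using \<pi>.hom_closed[of x] \<pi>.hom_mult[of x y] \<pi>.hom_add[of x y] \<pi>.hom_nat_pow[of x n]
    by (simp_all add: P_simps pow_ring_of_type_algebra)
  let ?\<phi> = "\<lambda>r. r [^]\<^bsub>R\<^esub> p"
  have \<phi>: "?\<phi> \<in> ring_hom R R"
  proof (rule ring_hom_memI)
    show "(x \<oplus>\<^bsub>R\<^esub> y) [^]\<^bsub>R\<^esub> p = x [^]\<^bsub>R\<^esub> p \<oplus>\<^bsub>R\<^esub> y [^]\<^bsub>R\<^esub> p"
      if "x \<in> carrier R" "y \<in> carrier R" for x y
    proof -
      obtain f g where fg: "x = \<pi> f" "y = \<pi> g" using \<pi>_surj \<open>x \<in> carrier R\<close> \<open>y \<in> carrier R\<close> by metis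
      have "(f + g) ^ p = f ^ p + g ^ p"
        by (rule freshmans_dream) (use p in \<open>simp_all add: p_def\<close>)
      then show ?thesis by (simp add: fg \<pi>_simps)
    qed
  qed (simp_all add: R.nat_pow_distrib)
  have pure: "pure_hom R R ?\<phi>"
    using pure by (simp add: F_pure_def quotient_ring2_def R_def p_def)
  obtain \<alpha> \<beta> where \<alpha>\<beta>: "\<alpha> * s + \<beta> * u = 1" using exists_lin_eq_1[OF su(1)] by blast
  define l where "l = lin \<alpha> \<beta>"
  define t where "t = lin u (- s)"
  have "p + d - 1 \<le> (d - 1) * p"
  proof -
    obtain e q where "d = e + 3" "p = q + 2" using h(2) p2 by (metis le_add_diff_inverse2)
    then show ?thesis by (simp add: algebra_simps)
  qed
  then obtain e where e: "(d - 1) * p = e + (p + d - 1)" by (metis le_add_diff_inverse2)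
  have "is_form (p + d - 1) (l ^ (p + d - 1))"
    using is_form_power[OF is_form_lin] by (simp add: l_def)
  from form_in_power_ideal[OF h(1) su(2) \<alpha>\<beta> _ this] h(2)
  obtain a b where ab: "l ^ (p + d - 1) = a * t ^ p + b * h" by (auto simp: t_def)
  have "(l ^ (d - 1)) ^ p - (l ^ e * a) * t ^ p = (l ^ e * b) * h"
    unfolding power_mult[symmetric] e power_add[of l e] ab by (simp add: algebra_simps)
  then have "\<pi> ((l ^ (d - 1)) ^ p) = \<pi> ((l ^ e * a) * t ^ p)" unfolding \<pi>_eq_iff by simp
  then have "?\<phi> (\<pi> (l ^ (d - 1))) = \<pi> (l ^ e * a) \<otimes>\<^bsub>R\<^esub> ?\<phi> (\<pi> t)"
    by (simp add: \<pi>_simps)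
  then have "?\<phi> (\<pi> (l ^ (d - 1))) \<in> PIdl\<^bsub>R\<^esub> (?\<phi> (\<pi> t))"
    unfolding cgenideal_def using \<pi>_simps(1) by blast
  then have "\<pi> (l ^ (d - 1)) \<in> PIdl\<^bsub>R\<^esub> (\<pi> t)"
    by (rule pure_hom_contracts_principal_ideal[OF R R \<phi> pure \<pi>_simps(1) \<pi>_simps(1)])
  then obtain x where "x \<in> carrier R" "\<pi> (l ^ (d - 1)) = x \<otimes>\<^bsub>R\<^esub> \<pi> t"
    unfolding cgenideal_def by blast
  then obtain g where "\<pi> (l ^ (d - 1)) = \<pi> (g * t)" using \<pi>_surj \<pi>_simps(2) by metis
  then obtain k where k: "l ^ (d - 1) - g * t = h * k" unfolding \<pi>_eq_iff by (auto elim: dvdE)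
  \<comment> \<open>Restriction to the line through \<open>(s, u)\<close>, with \<open>x\<close> as the coordinate on it.\<close>
  define \<sigma> where "\<sigma> = (\<lambda>f. subst2 f (const2 s * varX) (const2 u * varX))"
  have \<sigma>_form: "\<sigma> f = const2 (eval2 f s u) * varX ^ n" if "is_form n f" for n f
    unfolding \<sigma>_def by (rule subst2_form_line[OF that])
  have "\<sigma> l = varX" "\<sigma> t = 0"
    unfolding l_def t_def \<sigma>_form[OF is_form_lin] by (simp_all add: \<alpha>\<beta>)
  moreover have "l ^ (d - 1) = g * t + h * k" using k by (simp add: algebra_simps)
  then have "\<sigma> (l ^ (d - 1)) = \<sigma> (g * t + h * k)" by simp
  ultimately have "varX ^ (d - 1) = \<sigma> h * \<sigma> k" by (simp add: \<sigma>_def)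
  also have "\<dots> = varX ^ (d - 1) * (const2 (eval2 h s u) * varX * \<sigma> k)"
    unfolding \<sigma>_form[OF h(1)] using h(2) by (cases d) (simp_all add: mult_ac)
  finally have "varX ^ (d - 1) * (const2 (eval2 h s u) * varX * \<sigma> k - 1) = 0"
    by (simp add: algebra_simps)
  moreover have "varX \<noteq> (0 :: 'a poly poly)" by (simp add: varX_def)
  ultimately have "const2 (eval2 h s u) * varX * \<sigma> k = 1" by simp
  \<comment> \<open>The left-hand side vanishes at the origin.\<close>
  then have "eval2 (const2 (eval2 h s u) * varX * \<sigma> k) 0 0 = eval2 1 0 0" by simp
  then show False by simp
qed


section \<open>The classification of binary cubics\<close>

theorem lemma4p3:
  fixes h :: "'a::alg_closed_field poly poly"
  assumes "is_form 3 h" and "h \<noteq> 0"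
  shows "(\<exists>!i. i < 3 \<and>
            brought_to h ([varX ^ 3, varX ^ 2 * varY, varX * varY * (varX + varY)] ! i)) \<and>
         cubic_with_three_distinct_roots (varX * varY * (varX + varY) :: 'a poly poly) \<and>
         (\<forall>g :: 'a poly poly. cubic_with_three_distinct_roots g \<longrightarrow>
            (\<exists>!i. i < 3 \<and> brought_to h ([varX ^ 3, varX ^ 2 * varY, g] ! i))) \<and>
         (CHAR('a) > 0 \<longrightarrow> \<not> F_pure CHAR('a) (quotient_ring2 h))"
proof (intro conjI allI impI)
  show c: "cubic_with_three_distinct_roots (varX * varY * (varX + varY) :: 'a poly poly)"
    unfolding cubic_with_three_distinct_roots_def by (simp only: normal_forms_roots)
  show *: "\<exists>!i. i < 3 \<and> brought_to h ([varX ^ 3, varX ^ 2 * varY, g] ! i)"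
    if "cubic_with_three_distinct_roots g" for g
    using unique_normal_form[OF assms that] .
  show "\<exists>!i. i < 3 \<and> brought_to h ([varX ^ 3, varX ^ 2 * varY, varX * varY * (varX + varY)] ! i)"
    by (rule *[OF c])
  show "\<not> F_pure CHAR('a) (quotient_ring2 h)" if "CHAR('a) > 0"
    using exists_nonroot[OF assms] not_F_pure_quotient_by_form[OF assms(1) order_refl _ _ that] by blast
qed

end
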